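(* There is an algorithm that computes an optimal routing for the Vehicle Routing Problem (VRP) in $|C|^{O(|C|)}\cdot n^{O(1)}$ steps, where $C$ is the set of clients and $n=|V(G)|$ is the number of vertices of the input graph.
   Context: All graphs are finite and undirected, and $\mathbb N = \{0,1,2,\dots\}$. A walk in $G$ is a sequence of vertices $(v_1,\dots,v_m)$ with consecutive vertices adjacent; vertices and edges may be repeated. It is closed if $v_1 = v_m$. For edge weights $w\colon E(G)\to\mathbb N$, the weight of a walk is $w(p)=\sum_{i=1}^{m-1} w(v_i,v_{i+1})$. VRP: The input consists of a graph $G$ with edge weights $w\colon E(G)\to\mathbb N$, a nonempty set of depots $D\subseteq V(G)$, a set of clients $C\subseteq V(G)$, and a number of vehicles $k\in\mathbb N$. A routing is a set of $k'$ walks $R=\{p_1,\dots,p_{k'}\}$ (one walk per vehicle) together with an assignment $A\colon C\to[k']$ such that $k'\le k$, every walk starts at a vertex of $D$, every client $c\in C$ is a vertex of $p_{A(c)}$, and every walk in $R$ is closed. Its weight is $w(R)=\sum_{p\in R}w(p)$; a routing of minimum weight is called optimal. *)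

theory Defs
  imports Main
begin

section \<open>The Vehicle Routing Problem\<close>

text \<open>
  Edges are unordered pairs, represented as sets \<open>{u, v}\<close>, so that adjacency and weights are
  symmetric by construction. Loops (\<open>u = v\<close>) are permitted but not required. Only the values of
  \<^term>\<open>weight I\<close> on \<^term>\<open>edges I\<close> are ever used.
\<close>

record 'v vrp =
  verts :: "'v set"
  edges :: "'v set set"
  weight :: "'v set \<Rightarrow> nat"
  depots :: "'v set"
  clients :: "'v set"
  vehicles :: nat

definition vrp_instance :: "'v vrp \<Rightarrow> bool" where
  "vrp_instance I \<longleftrightarrow>
     finite (verts I) \<and>
     edges I \<subseteq> {{u, v} | u v. u \<in> verts I \<and> v \<in> verts I} \<and>
     depots I \<noteq> {} \<and> depots I \<subseteq> verts I \<and>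
     clients I \<subseteq> verts I"

definition walk :: "'v vrp \<Rightarrow> 'v list \<Rightarrow> bool" where
  "walk I p \<longleftrightarrow> p \<noteq> [] \<and> set p \<subseteq> verts I \<and> successively (\<lambda>u v. {u, v} \<in> edges I) p"

definition closed_walk :: "'v vrp \<Rightarrow> 'v list \<Rightarrow> bool" where
  "closed_walk I p \<longleftrightarrow> walk I p \<and> hd p = last p"

definition walk_weight :: "'v vrp \<Rightarrow> 'v list \<Rightarrow> nat" where
  "walk_weight I p = (\<Sum>i < length p - 1. weight I {p ! i, p ! Suc i})"

text \<open>
  A routing with \<open>k'\<close> walks is a list \<open>R\<close> of length \<open>k'\<close> (one walk per vehicle, so two vehicles may
  use the same walk and both are paid for). The index set \<open>[k']\<close> is \<open>{0, \<dots>, k' - 1}\<close>; the values of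
  the assignment \<open>A\<close> outside the clients are irrelevant.
\<close>

definition routing :: "'v vrp \<Rightarrow> 'v list list \<Rightarrow> ('v \<Rightarrow> nat) \<Rightarrow> bool" where
  "routing I R A \<longleftrightarrow>
     length R \<le> vehicles I \<and>
     (\<forall>p \<in> set R. closed_walk I p \<and> hd p \<in> depots I) \<and>
     (\<forall>c \<in> clients I. A c < length R \<and> c \<in> set (R ! A c))"

definition routing_weight :: "'v vrp \<Rightarrow> 'v list list \<Rightarrow> nat" where
  "routing_weight I R = (\<Sum>p \<leftarrow> R. walk_weight I p)"

definition optimal_routing :: "'v vrp \<Rightarrow> 'v list list \<Rightarrow> ('v \<Rightarrow> nat) \<Rightarrow> bool" where
  "optimal_routing I R A \<longleftrightarrow>
     routing I R A \<and>
     (\<forall>R' A'. routing I R' A' \<longrightarrow> routing_weight I R \<le> routing_weight I R')"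


section \<open>Random access machine\<close>

text \<open>
  A unit-cost random access machine, programmed in a structured language. The memory consists of
  named arrays of natural numbers; scalars are cells with index \<open>0\<close>. A program mentions only
  finitely many array names, so the arrays could be interleaved in a single linear memory. The
  arithmetic operations are addition and truncated subtraction. Multiplication is deliberately not
  a unit-cost operation: it would allow numbers of exponential bit length to be built in
  polynomially many steps. Weights are unbounded and one operation on them counts as one step.
\<close>

type_synonym memory = "string \<Rightarrow> nat \<Rightarrow> nat"

datatype exp =
    Const nat
  | Cell string exp
  | Plus exp exp
  | Minus exp exp

datatype com =
    Skip
  | Store string exp exp
  | Seq com com
  | If exp com com
  | While exp com

fun val :: "exp \<Rightarrow> memory \<Rightarrow> nat" where
  "val (Const m) s = m"
| "val (Cell x e) s = s x (val e s)"
| "val (Plus e f) s = val e s + val f s"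
| "val (Minus e f) s = val e s - val f s"

fun exp_steps :: "exp \<Rightarrow> nat" where
  "exp_steps (Const m) = 1"
| "exp_steps (Cell x e) = 1 + exp_steps e"
| "exp_steps (Plus e f) = 1 + exp_steps e + exp_steps f"
| "exp_steps (Minus e f) = 1 + exp_steps e + exp_steps f"

text \<open>
  \<open>exec P s t s'\<close>: started in memory \<open>s\<close>, the program \<open>P\<close> halts after exactly \<open>t\<close> steps in memory
  \<open>s'\<close>. A guard counts as true iff its value is not \<open>0\<close>.
\<close>

inductive exec :: "com \<Rightarrow> memory \<Rightarrow> nat \<Rightarrow> memory \<Rightarrow> bool" where
  Skip: "exec Skip s 1 s"
| Store: "exec (Store x e f) s (1 + exp_steps e + exp_steps f)
            (s(x := (s x)(val e s := val f s)))"
| Seq: "exec P s t s' \<Longrightarrow> exec Q s' u s'' \<Longrightarrow> exec (Seq P Q) s (t + u) s''"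
| IfTrue: "val e s \<noteq> 0 \<Longrightarrow> exec P s t s' \<Longrightarrow> exec (If e P Q) s (1 + exp_steps e + t) s'"
| IfFalse: "val e s = 0 \<Longrightarrow> exec Q s t s' \<Longrightarrow> exec (If e P Q) s (1 + exp_steps e + t) s'"
| WhileFalse: "val e s = 0 \<Longrightarrow> exec (While e P) s (1 + exp_steps e) s"
| WhileTrue: "val e s \<noteq> 0 \<Longrightarrow> exec P s t s' \<Longrightarrow> exec (While e P) s' u s'' \<Longrightarrow>
    exec (While e P) s (1 + exp_steps e + t + u) s''"

text \<open>The machine is deterministic, so a halting run is the run of the program.\<close>

lemma exec_deterministic: "exec P s t s' \<Longrightarrow> exec P s u s'' \<Longrightarrow> u = t \<and> s'' = s'"
proof (induction arbitrary: u s'' rule: exec.induct)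
  case (Skip s)
  then show ?case by cases auto
next
  case (Store x e f s)
  then show ?case by cases auto
next
  case (Seq P s t s' Q v r)
  from Seq.prems obtain t1 m t2 where "exec P s t1 m" "exec Q m t2 s''" "u = t1 + t2"
    by cases auto
  with Seq.IH show ?case by blast
next
  case (IfTrue e s P t s' Q)
  from IfTrue.prems IfTrue.hyps obtain t1 where "exec P s t1 s''" "u = 1 + exp_steps e + t1"
    by cases auto
  with IfTrue.IH show ?case by blast
next
  case (IfFalse e s Q t s' P)
  from IfFalse.prems IfFalse.hyps obtain t1 where "exec Q s t1 s''" "u = 1 + exp_steps e + t1"
    by cases auto
  with IfFalse.IH show ?case by blast
next
  case (WhileFalse e s P)
  from WhileFalse.prems WhileFalse.hyps show ?case by cases auto
next
  case (WhileTrue e s P t s' v r)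
  from WhileTrue.prems WhileTrue.hyps obtain t1 m t2
    where "exec P s t1 m" "exec (While e P) m t2 s''" "u = 1 + exp_steps e + t1 + t2"
    by cases auto
  with WhileTrue.IH show ?case by blast
qed


section \<open>Input and output conventions\<close>

text \<open>
  The vertices of an input graph with \<open>n\<close> vertices are numbered \<open>0, \<dots>, n - 1\<close>. The graph is given by
  its adjacency matrix and its weight matrix, in row-major order; depots and clients are given by
  their characteristic vectors. All other cells are initially \<open>0\<close>.
\<close>

definition input_memory :: "nat vrp \<Rightarrow> memory" where
  "input_memory I =
    (let n = card (verts I);
         adjacent = (\<lambda>i. i < n * n \<and> {i div n, i mod n} \<in> edges I)
     in (\<lambda>_ _. 0)
       (''n'' := (\<lambda>_. 0)(0 := n),
        ''k'' := (\<lambda>_. 0)(0 := vehicles I),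
        ''adj'' := (\<lambda>i. if adjacent i then 1 else 0),
        ''w'' := (\<lambda>i. if adjacent i then weight I {i div n, i mod n} else 0),
        ''D'' := (\<lambda>v. if v \<in> depots I then 1 else 0),
        ''C'' := (\<lambda>v. if v \<in> clients I then 1 else 0)))"

text \<open>
  On halting, \<open>''feasible''\<close> tells whether the instance has a routing at all. If it does,
  \<open>''count''\<close> holds the number of walks, walk \<open>i\<close> is the segment of \<open>''walk''\<close> from \<open>''start''[i]\<close>
  (inclusive) to \<open>''start''[i + 1]\<close> (exclusive), and client \<open>c\<close> is assigned to walk \<open>''assign''[c]\<close>.
\<close>

definition output_walks :: "memory \<Rightarrow> nat list list" where
  "output_walks s =
     map (\<lambda>i. map (s ''walk'') [s ''start'' i ..< s ''start'' (Suc i)]) [0 ..< s ''count'' 0]"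

definition output_assignment :: "memory \<Rightarrow> nat \<Rightarrow> nat" where
  "output_assignment s = s ''assign''"

definition correct_output :: "nat vrp \<Rightarrow> memory \<Rightarrow> bool" where
  "correct_output I s \<longleftrightarrow>
     (if \<exists>R A. routing I R A
      then s ''feasible'' 0 = 1 \<and> optimal_routing I (output_walks s) (output_assignment s)
      else s ''feasible'' 0 = 0)"

end

theory Submission
  imports Defs
begin

text \<open>
  A routing is a path in a graph whose states record the clients already covered, the number of
  vehicles still available, the depot of the current walk and the current vertex. Moving along an
  edge costs its weight, and a vehicle that is back at its depot may be replaced, for free, by a new
  one at any depot; the path ends at a depot with all clients covered. At most \<open>n\<close> vehicles are
  useful, so with \<open>m\<close> clients there are at most \<open>N = 2^m (n + 1)^3\<close> states, and cutting cycles
  shows that paths of at most \<open>N\<close> steps suffice. Tabulating the least cost to the goal for each state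
  and each bound on the number of steps takes time polynomial in \<open>N\<close>, and following the recorded
  best choices emits an optimal routing; having one table per step bound avoids running in circles
  of weight \<open>0\<close>. Finally \<open>2^m \<le> 2 m^m\<close>.
\<close>

section \<open>Time-bounded runs\<close>

text \<open>The depot of the current walk belongs to the state because only its comparison with the
  current vertex tells whether the walk is closed. The number of vehicles is not bounded in terms of
  \<open>n\<close>, so it is capped before it becomes a component of the state. Clients are indexed
  by their rank among the clients, which gives \<open>2^m\<close> masks instead of
  \<open>2^n\<close>. The machine has no multiplication, division or bit operation, so even
  \<open>N\<close> and the decoding of states must be computed by counting loops. Every loop, these
  included, makes at most \<open>N\<close> iterations; hence the number of steps is polynomial in
  \<open>N\<close>, with constants fixed by the program text, and no running time has to be computed
  exactly. Optimality has two halves: the table bounds the weight of every routing from below, and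
  the trace emits a routing that attains this bound.\<close>

text \<open>Bounds the steps of a run in which every loop makes at most \<open>X\<close> iterations.\<close>

fun cost :: "com \<Rightarrow> nat \<Rightarrow> nat" where
  "cost Skip X = 1"
| "cost (Store x e f) X = 1 + exp_steps e + exp_steps f"
| "cost (Seq P Q) X = cost P X + cost Q X"
| "cost (If e P Q) X = 1 + exp_steps e + cost P X + cost Q X"
| "cost (While e P) X = (X + 1) * (1 + exp_steps e + cost P X)"

text \<open>Sequencing adds two such bounds, and a loop multiplies by
  \<open>X + 1 \<le> X + X\<close>, which raises the degree by one. The constants depend on the
  program alone, so it remains to bound all iteration counts by one \<open>X\<close>.\<close>

lemma cost_polynomial: "\<exists>a d. \<forall>X\<ge>1. cost P X \<le> a * X ^ d"
proof -
  have const: "c \<le> c * X ^ d" if "X \<ge> 1" for c X d :: nat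
    using that by simp
  have add: "\<exists>a d. \<forall>X\<ge>1. f X + g X \<le> a * X ^ d"
    if "\<exists>a d. \<forall>X\<ge>1. f X \<le> a * X ^ d" "\<exists>a d. \<forall>X\<ge>1. g X \<le> a * X ^ d" for f g :: "nat \<Rightarrow> nat"
  proof -
    from that obtain a d b e where
      *: "\<And>X. X \<ge> 1 \<Longrightarrow> f X \<le> a * X ^ d" "\<And>X. X \<ge> 1 \<Longrightarrow> g X \<le> b * X ^ e"
      by blast
    have "f X + g X \<le> (a + b) * X ^ (d + e)" if X: "X \<ge> 1" for X
    proof -
      have "X ^ d \<le> X ^ (d + e)" "X ^ e \<le> X ^ (d + e)"
        using X by (simp_all add: power_increasing)
      with *[OF X] have "f X \<le> a * X ^ (d + e)" "g X \<le> b * X ^ (d + e)"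
        by (meson le_trans mult_le_mono2)+
      then show ?thesis by (simp add: add_mult_distrib)
    qed
    then show ?thesis by blast
  qed
  have c: "\<exists>a d. \<forall>X\<ge>1. c \<le> a * X ^ d" for c :: nat
    using const by blast
  show ?thesis
  proof (induction P)
    case Skip
    then show ?case using c[of 1] by simp
  next
    case (Store x e f)
    then show ?case using c[of "1 + exp_steps e + exp_steps f"] by simp
  next
    case (Seq P Q)
    then show ?case using add by simp
  next
    case (If e P Q)
    then show ?case using add[OF add[OF c[of "1 + exp_steps e"]]] by simp
  next
    case (While e P)
    obtain a d where *: "\<And>X. X \<ge> 1 \<Longrightarrow> 1 + exp_steps e + cost P X \<le> a * X ^ d"
      using add[OF c[of "1 + exp_steps e"] While] by blast
    have "cost (While e P) X \<le> (2 * a) * X ^ Suc d" if X: "X \<ge> 1" for X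
    proof -
      have "cost (While e P) X \<le> (X + X) * (a * X ^ d)"
        using *[OF X] X unfolding cost.simps by (intro mult_le_mono) auto
      then show ?thesis by (simp add: algebra_simps)
    qed
    then show ?case by blast
  qed
qed

text \<open>Total correctness with a time bound. By \<open>exec_deterministic\<close> the run whose
  existence is claimed is the only one.\<close>

definition runs :: "nat \<Rightarrow> com \<Rightarrow> memory \<Rightarrow> (memory \<Rightarrow> bool) \<Rightarrow> bool" where
  "runs X P s Q \<longleftrightarrow> (\<exists>t s'. exec P s t s' \<and> t \<le> cost P X \<and> Q s')"

fun mods :: "com \<Rightarrow> string set" where
  "mods Skip = {}"
| "mods (Store x e f) = {x}"
| "mods (Seq P Q) = mods P \<union> mods Q"
| "mods (If e P Q) = mods P \<union> mods Q"
| "mods (While e P) = mods P"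

lemma exec_unmodified: "exec P s t s' \<Longrightarrow> y \<notin> mods P \<Longrightarrow> s' y = s y"
  by (induction rule: exec.induct) auto

lemma runs_Skip: "Q s \<Longrightarrow> runs X Skip s Q"
  unfolding runs_def using exec.Skip by fastforce

lemma runs_Store: "Q (s(x := (s x)(val e s := val f s))) \<Longrightarrow> runs X (Store x e f) s Q"
  unfolding runs_def using exec.Store by fastforce

lemma runs_Seq: "runs X P s (\<lambda>s'. runs X P' s' Q) \<Longrightarrow> runs X (Seq P P') s Q"
  unfolding runs_def using exec.Seq by (fastforce intro: add_mono)

lemma runs_If:
  assumes "val e s \<noteq> 0 \<Longrightarrow> runs X P s Q" and "val e s = 0 \<Longrightarrow> runs X P' s Q"
  shows "runs X (If e P P') s Q"
proof (cases "val e s = 0")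
  case True
  then obtain t s' where "exec P' s t s'" "t \<le> cost P' X" "Q s'"
    using assms(2) unfolding runs_def by blast
  with exec.IfFalse[OF True this(1), of P] show ?thesis
    unfolding runs_def by fastforce
next
  case False
  then obtain t s' where "exec P s t s'" "t \<le> cost P X" "Q s'"
    using assms(1) unfolding runs_def by blast
  with exec.IfTrue[OF False this(1), of P'] show ?thesis
    unfolding runs_def by fastforce
qed

lemmas runs_intros = runs_Skip runs_Store runs_Seq runs_If

text \<open>As rewrite rules these keep the memory term small, since it is simplified after every store.\<close>

lemma runs_Store_simps:
  "runs X (Store x e f) s Q \<longleftrightarrow> Q (s(x := (s x)(val e s := val f s)))"
  "runs X (Seq (Store x e f) P) s Q \<longleftrightarrow> runs X P (s(x := (s x)(val e s := val f s))) Q"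
proof -
  have *: "exec (Store x e f) s t s' \<longleftrightarrow>
      t = 1 + exp_steps e + exp_steps f \<and> s' = s(x := (s x)(val e s := val f s))" for t s'
    using exec.Store exec_deterministic by blast
  show "runs X (Store x e f) s Q \<longleftrightarrow> Q (s(x := (s x)(val e s := val f s)))"
    unfolding runs_def * by simp
  have **: "exec (Seq (Store x e f) P) s t s' \<longleftrightarrow> (\<exists>u. t = 1 + exp_steps e + exp_steps f + u \<and>
      exec P (s(x := (s x)(val e s := val f s))) u s')" for t s'
  proof
    assume "exec (Seq (Store x e f) P) s t s'"
    then show "\<exists>u. t = 1 + exp_steps e + exp_steps f + u \<and>
        exec P (s(x := (s x)(val e s := val f s))) u s'"
      by cases (simp add: *)
  next
    assume "\<exists>u. t = 1 + exp_steps e + exp_steps f + u \<and>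
        exec P (s(x := (s x)(val e s := val f s))) u s'"
    then show "exec (Seq (Store x e f) P) s t s'"
      using exec.Seq[OF exec.Store] by blast
  qed
  have "(\<exists>t s'. (\<exists>u. t = c + u \<and> R u s') \<and> t \<le> c + d \<and> Q s') \<longleftrightarrow> (\<exists>t s'. R t s' \<and> t \<le> d \<and> Q s')"
    for c d :: nat and R :: "nat \<Rightarrow> memory \<Rightarrow> bool"
    by (metis add_le_cancel_left)
  then show "runs X (Seq (Store x e f) P) s Q \<longleftrightarrow> runs X P (s(x := (s x)(val e s := val f s))) Q"
    unfolding runs_def ** cost.simps .
qed

lemma runs_conseq: "runs X P s Q \<Longrightarrow> (\<And>s'. Q s' \<Longrightarrow> Q' s') \<Longrightarrow> runs X P s Q'"
  unfolding runs_def by blast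

text \<open>Makes the unmodified arrays known when the postcondition is proved, so that
  specifications mention only what a program changes.\<close>

lemma runs_frame:
  "runs X P s (\<lambda>s'. (\<forall>y. y \<notin> mods P \<longrightarrow> s' y = s y) \<longrightarrow> Q s') \<Longrightarrow> runs X P s Q"
  unfolding runs_def using exec_unmodified by blast

lemma runs_SeqI:
  assumes "runs X P s R" "\<And>t. (\<And>y. y \<notin> mods P \<Longrightarrow> t y = s y) \<Longrightarrow> R t \<Longrightarrow> runs X Q t S"
  shows "runs X (Seq P Q) s S"
  by (rule runs_Seq, rule runs_frame, rule runs_conseq[OF assms(1)]) (use assms(2) in blast)

abbreviation Var :: "string \<Rightarrow> exp" where "Var x \<equiv> Cell x (Const 0)"
abbreviation Assign :: "string \<Rightarrow> exp \<Rightarrow> com" where "Assign x e \<equiv> Store x (Const 0) e"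

fun block :: "com list \<Rightarrow> com" where
  "block [] = Skip"
| "block [P] = P"
| "block (P # Ps) = Seq P (block Ps)"

text \<open>Truncated subtraction serves as the comparison: the guard is nonzero exactly while
  \<open>x\<close> is below \<open>b\<close>.\<close>

definition For :: "string \<Rightarrow> string \<Rightarrow> com \<Rightarrow> com" where
  "For x b P = Seq (Assign x (Const 0))
     (While (Minus (Var b) (Var x)) (Seq P (Assign x (Plus (Var x) (Const 1)))))"

lemma mods_For [simp]: "mods (For x b P) = insert x (mods P)"
  by (auto simp: For_def)

text \<open>Progress is the argument \<open>j\<close> of the invariant, and \<open>indep\<close>
  keeps the invariant from reading the counter, so setting and incrementing the counter preserve it.
  The frame facts in \<open>step\<close> and \<open>post\<close> save restating what the loop leaves
  alone.\<close>

lemma runs_For: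
  assumes bound: "s b 0 = K" "K \<le> X" "b \<noteq> x" "b \<notin> mods P" "x \<notin> mods P"
    and indep: "\<And>j t g. Inv j t \<Longrightarrow> Inv j (t(x := g))"
    and init: "Inv 0 s"
    and step: "\<And>j t. j < K \<Longrightarrow> (\<And>y. y \<notin> insert x (mods P) \<Longrightarrow> t y = s y) \<Longrightarrow> t x 0 = j
      \<Longrightarrow> Inv j t \<Longrightarrow> runs X P t (Inv (Suc j))"
    and post: "\<And>t. (\<And>y. y \<notin> insert x (mods P) \<Longrightarrow> t y = s y) \<Longrightarrow> Inv K t \<Longrightarrow> Q t"
  shows "runs X (For x b P) s Q"
proof -
  define W where "W = While (Minus (Var b) (Var x)) (Seq P (Assign x (Plus (Var x) (Const 1))))"
  \<comment> \<open>Evaluating the guard costs 6 steps and so does the increment; the initial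
    assignment costs 3.\<close>
  define c where "c = 6 + (cost P X + 6)"
  \<comment> \<open>Induction on the number \<open>i\<close> of iterations still to come; the extra
    unit in \<open>Suc i\<close> pays for the final, failing guard.\<close>
  have loop: "\<exists>u t'. exec W t u t' \<and> u \<le> Suc i * c \<and> Q t'"
    if "i \<le> K" "\<And>y. y \<notin> insert x (mods P) \<Longrightarrow> t y = s y" "t x 0 = K - i" "Inv (K - i) t" for i t
    using that
  proof (induction i arbitrary: t)
    case 0
    have "t b 0 = K" using 0 bound by auto
    then have "exec W t 6 t"
      using exec.WhileFalse[of "Minus (Var b) (Var x)" t] 0 unfolding W_def by (simp add: numeral_eq_Suc)
    moreover have "Q t" using 0 post by auto
    ultimately show ?case unfolding c_def by fastforce
  next
    case (Suc i)
    have b: "t b 0 = K" using Suc.prems bound by auto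
    have "runs X P t (Inv (Suc (K - Suc i)))"
      using Suc.prems by (intro step) auto
    then obtain u t1 where t1: "exec P t u t1" "u \<le> cost P X" "Inv (K - i) t1"
      unfolding runs_def using Suc.prems(1) by (auto simp: Suc_diff_Suc)
    have f: "t1 y = t y" if "y \<notin> mods P" for y
      using exec_unmodified[OF t1(1) that] .
    define t2 where "t2 = t1(x := (t1 x)(0 := K - i))"
    have "exec (Assign x (Plus (Var x) (Const 1))) t1 6 t2"
      using exec.Store[of x "Const 0" "Plus (Var x) (Const 1)" t1] f[of x] bound Suc.prems
      unfolding t2_def by (simp add: Suc_diff_Suc numeral_eq_Suc)
    with t1 have body: "exec (Seq P (Assign x (Plus (Var x) (Const 1)))) t (u + 6) t2"
      by (intro exec.Seq)
    have "Inv (K - i) t2"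
      unfolding t2_def by (rule indep[OF t1(3)])
    moreover have "t2 y = s y" if "y \<notin> insert x (mods P)" for y
      using that Suc.prems(2) f unfolding t2_def by auto
    moreover have "t2 x 0 = K - i"
      unfolding t2_def by simp
    ultimately have "\<exists>v t'. exec W t2 v t' \<and> v \<le> Suc i * c \<and> Q t'"
      using Suc.prems(1) by (intro Suc.IH) auto
    then obtain v t' where v: "exec W t2 v t'" "v \<le> Suc i * c" "Q t'" by blast
    have "exec W t (6 + (u + 6) + v) t'"
      using exec.WhileTrue[OF _ body, of "Minus (Var b) (Var x)" v t'] v Suc.prems b
      unfolding W_def by (simp add: numeral_eq_Suc)
    moreover have "6 + (u + 6) + v \<le> Suc (Suc i) * c"
      using v t1 unfolding c_def by simp
    ultimately show ?case using v by blast
  qed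
  define t0 where "t0 = s(x := (s x)(0 := 0))"
  have "Inv 0 t0"
    unfolding t0_def by (rule indep[OF init])
  moreover have "t0 y = s y" if "y \<notin> insert x (mods P)" for y
    using that unfolding t0_def by auto
  moreover have "t0 x 0 = 0"
    unfolding t0_def by simp
  ultimately have "\<exists>u t'. exec W t0 u t' \<and> u \<le> Suc K * c \<and> Q t'"
    by (intro loop) auto
  then obtain u t' where u: "exec W t0 u t'" "u \<le> Suc K * c" "Q t'" by blast
  have "exec (Assign x (Const 0)) s 3 t0"
    using exec.Store[of x "Const 0" "Const 0" s] unfolding t0_def by (simp add: numeral_eq_Suc)
  from exec.Seq[OF this u(1)] have "exec (For x b P) s (3 + u) t'"
    unfolding For_def W_def .
  moreover have "3 + u \<le> cost (For x b P) X"
  proof -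
    have "u \<le> Suc X * c" using u(2) bound(2) by (meson Suc_le_mono le_trans mult_le_mono1)
    then show ?thesis unfolding For_def c_def by (simp add: algebra_simps)
  qed
  ultimately show ?thesis unfolding runs_def using u(3) by blast
qed

section \<open>The state graph\<close>

lemma mult_add_less: "a < A \<Longrightarrow> c < b \<Longrightarrow> a * b + c < A * (b :: nat)"
proof -
  assume "a < A" "c < b"
  then have "a * b + c < Suc a * b" by simp
  also have "\<dots> \<le> A * b" using \<open>a < A\<close> by (intro mult_le_mono) auto
  finally show ?thesis .
qed

locale numbered_vrp =
  fixes I :: "nat vrp" and n :: nat
  assumes inst: "vrp_instance I" and verts: "verts I = {..<n}"
begin

section \<open>Sets of clients as bit masks\<close>

definition M :: nat where "M = 2 ^ card (clients I)"

text \<open>Numbering the clients by rank, not by vertex, is what keeps the masks below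
  \<open>2 ^ card (clients I)\<close>.\<close>

definition rank :: "nat \<Rightarrow> nat" where "rank v = card (clients I \<inter> {..<v})"

text \<open>
  Sets of clients are bit masks, with bit \<open>rank v\<close> for the client \<open>v\<close>; \<open>gain q v\<close> is what visiting
  \<open>v\<close> adds to the mask \<open>q\<close>.
\<close>

definition gain :: "nat \<Rightarrow> nat \<Rightarrow> nat" where
  "gain q v = (if v \<in> clients I \<and> even (q div 2 ^ rank v) then 2 ^ rank v else 0)"

definition visit :: "nat \<Rightarrow> nat \<Rightarrow> nat" where "visit q v = q + gain q v"

definition covered :: "nat \<Rightarrow> nat set" where "covered q = {v \<in> clients I. bit q (rank v)}"

text \<open>There is a depot, hence a vertex. This permits \<open>n + 1 \<le> 2 * n\<close> in
  \<open>N_le\<close>.\<close>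

lemma n_pos: "n > 0"
  using inst verts unfolding vrp_instance_def by auto

lemma clients_subset: "clients I \<subseteq> {..<n}" and depots_subset: "depots I \<subseteq> {..<n}"
  using inst verts unfolding vrp_instance_def by auto

lemma finite_clients [simp]: "finite (clients I)"
  using clients_subset finite_subset by blast

lemma card_clients_le: "card (clients I) \<le> n"
  using card_mono[OF _ clients_subset] by simp

lemma edge_bounds: "{u, v} \<in> edges I \<Longrightarrow> u < n \<and> v < n"
  using inst verts unfolding vrp_instance_def by (auto simp: doubleton_eq_iff)

lemma rank_strict_mono: "v \<in> clients I \<Longrightarrow> v < u \<Longrightarrow> rank v < rank u"
  unfolding rank_def by (rule psubset_card_mono) auto

lemma rank_less: "v \<in> clients I \<Longrightarrow> rank v < card (clients I)"
  unfolding rank_def by (rule psubset_card_mono) auto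

text \<open>Ranks are injective and lie below the number of clients, so by cardinality no bit
  position is left without a client.\<close>

lemma rank_image: "rank ` clients I = {..<card (clients I)}"
proof (rule card_subset_eq)
  have "inj_on rank (clients I)"
    by (intro inj_onI) (metis less_irrefl linorder_neqE_nat rank_strict_mono)
  then show "card (rank ` clients I) = card {..<card (clients I)}"
    by (simp add: card_image)
qed (use rank_less in auto)

text \<open>The bit is added only where it is missing, so no carry occurs and addition acts as a bit
  operation.\<close>

lemma visit_eq: "visit q v = (if v \<in> clients I then set_bit (rank v) q else q)"
  unfolding visit_def gain_def set_bit_eq bit_iff_odd by simp

lemma covered_0 [simp]: "covered 0 = {}"
  by (simp add: covered_def)

lemma covered_visit: "covered (visit q v) = covered q \<union> ({v} \<inter> clients I)"
proof -
  have "rank u = rank w \<longleftrightarrow> u = w" if "u \<in> clients I" "w \<in> clients I" for u w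
    using that rank_strict_mono by (metis less_irrefl linorder_neqE_nat)
  then show ?thesis
    unfolding covered_def visit_eq by (auto simp: bit_simps)
qed

text \<open>Lying below a power of two means being fixed by \<open>take_bit\<close>, and this
  survives setting a low bit.\<close>

lemma visit_less: "q < M \<Longrightarrow> visit q v < M"
proof -
  assume "q < M"
  then have "take_bit (card (clients I)) q = q"
    unfolding M_def by (simp add: take_bit_nat_eq_self)
  then have "take_bit (card (clients I)) (visit q v) = visit q v"
    using rank_less[of v] unfolding visit_eq by (auto simp: take_bit_set_bit_eq)
  then show ?thesis unfolding M_def by (simp add: take_bit_nat_eq_self_iff)
qed

text \<open>The ranks exhaust the bit positions, so full coverage is the mask of all ones, and the
  goal test becomes a single comparison.\<close>

lemma covered_full_iff: "q < M \<Longrightarrow> covered q = clients I \<longleftrightarrow> q = M - 1"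
proof -
  assume "q < M"
  then have t: "take_bit (card (clients I)) q = q"
    unfolding M_def by (simp add: take_bit_nat_eq_self)
  have "covered q = clients I \<longleftrightarrow> (\<forall>r < card (clients I). bit q r)"
  proof -
    have "covered q = clients I \<longleftrightarrow> (\<forall>r \<in> rank ` clients I. bit q r)"
      unfolding covered_def by auto
    then show ?thesis unfolding rank_image by auto
  qed
  also have "\<dots> \<longleftrightarrow> q = mask (card (clients I))"
  proof
    assume "\<forall>r < card (clients I). bit q r"
    then have "take_bit (card (clients I)) q = mask (card (clients I))"
      by (auto simp: bit_eq_iff bit_simps)
    with t show "q = mask (card (clients I))" by simp
  qed (simp add: bit_simps)
  finally show ?thesis by (simp add: M_def mask_eq_exp_minus_1)
qed

lemma M_pos [simp]: "M > 0"
  by (simp add: M_def)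

section \<open>States as numbers\<close>

definition N :: nat where "N = M * (n + 1) * (n + 1) * (n + 1)"

text \<open>
  States are numbers with base-\<open>(n + 1)\<close> digits. The digit \<open>n\<close>, which is not a vertex, stands for a
  garage in which the computation starts before the first vehicle departs.
\<close>

definition state :: "nat \<Rightarrow> nat \<Rightarrow> nat \<Rightarrow> nat \<Rightarrow> nat" where
  "state q j d v = ((q * (n + 1) + j) * (n + 1) + d) * (n + 1) + v"

definition pos :: "nat \<Rightarrow> nat" where "pos i = i mod (n + 1)"
definition home :: "nat \<Rightarrow> nat" where "home i = i div (n + 1) mod (n + 1)"
definition spare :: "nat \<Rightarrow> nat" where "spare i = i div (n + 1) div (n + 1) mod (n + 1)"
definition visited :: "nat \<Rightarrow> nat" where "visited i = i div (n + 1) div (n + 1) div (n + 1)"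

lemmas components = pos_def home_def spare_def visited_def

lemma state_components [simp]:
  assumes "j \<le> n" "d \<le> n" "v \<le> n"
  shows "pos (state q j d v) = v" "home (state q j d v) = d"
    "spare (state q j d v) = j" "visited (state q j d v) = q"
  using assms by (simp_all only: components state_def)
     (simp_all add: less_Suc_eq_le del: mult_Suc_right)

lemma components_le [simp]: "pos i \<le> n" "home i \<le> n" "spare i \<le> n"
  unfolding components by (metis Suc_eq_plus1 less_Suc_eq_le mod_less_divisor zero_less_Suc)+

lemma visited_less: "i < N \<Longrightarrow> visited i < M"
  unfolding components N_def by (simp add: less_mult_imp_div_less mult.assoc)

lemma state_less: "q < M \<Longrightarrow> j \<le> n \<Longrightarrow> d \<le> n \<Longrightarrow> v \<le> n \<Longrightarrow> state q j d v < N"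
proof -
  assume "q < M" "j \<le> n" "d \<le> n" "v \<le> n"
  then show ?thesis
    unfolding state_def N_def by (intro mult_add_less) auto
qed

text \<open>The garage also satisfies \<open>pos i = home i\<close>: the first vehicle may depart
  from it, and without clients the empty routing is already complete.\<close>

definition goal :: "nat \<Rightarrow> bool" where "goal i \<longleftrightarrow> pos i = home i \<and> visited i = M - 1"

section \<open>Transitions, paths and the removal of cycles\<close>

definition move :: "nat \<Rightarrow> nat \<Rightarrow> nat" where
  "move i u = state (visit (visited i) u) (spare i) (home i) u"

text \<open>The start of a new walk counts as visited, since a depot may itself be a client.\<close>

definition depart :: "nat \<Rightarrow> nat \<Rightarrow> nat" where
  "depart i u = state (visit (visited i) u) (spare i - 1) u u"

definition can_depart :: "nat \<Rightarrow> nat \<Rightarrow> bool" where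
  "can_depart i u \<longleftrightarrow> u \<in> depots I \<and> spare i > 0 \<and> pos i = home i"

text \<open>
  Triples of a kind (\<open>0\<close> stay, \<open>1\<close> move, \<open>2\<close> depart), the next state and the cost. Staying
  makes exactly \<open>l\<close> steps as good as at most \<open>l\<close> steps.
\<close>

definition choices :: "nat \<Rightarrow> nat \<Rightarrow> (nat \<times> nat \<times> nat) set" where
  "choices i m = {(0, i, 0)}
    \<union> {(1, move i u, weight I {pos i, u}) | u. u < m \<and> {pos i, u} \<in> edges I}
    \<union> {(2, depart i u, 0) | u. u < m \<and> can_depart i u}"

text \<open>The cap at \<open>n\<close> makes the vehicles fit into one digit and keeps
  \<open>N\<close> independent of \<open>vehicles I\<close>.\<close>

definition initial :: nat where "initial = state 0 (min (vehicles I) n) n n"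

lemma initial_less: "initial < N"
  unfolding initial_def by (intro state_less) auto

lemma choices_less: "(a, t, c) \<in> choices i n \<Longrightarrow> i < N \<Longrightarrow> t < N"
  by (auto simp: choices_def move_def depart_def diff_le_mono intro!: state_less visit_less visited_less)
    (meson components_le diff_le_self le_trans)

text \<open>The set \<open>S\<close> of admissible states is a parameter so that cutting cycles can
  be an induction on its size.\<close>

inductive reach :: "nat set \<Rightarrow> nat \<Rightarrow> nat \<Rightarrow> bool" for S where
  goal: "i \<in> S \<Longrightarrow> goal i \<Longrightarrow> reach S i 0"
| step: "i \<in> S \<Longrightarrow> (a, t, c) \<in> choices i n \<Longrightarrow> reach S t c' \<Longrightarrow> reach S i (c + c')"

fun reach_within :: "nat \<Rightarrow> nat \<Rightarrow> nat \<Rightarrow> bool" where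
  "reach_within 0 i c \<longleftrightarrow> goal i \<and> c = 0"
| "reach_within (Suc l) i c \<longleftrightarrow>
     (\<exists>a t b c'. (a, t, b) \<in> choices i n \<and> reach_within l t c' \<and> c = b + c')"

text \<open>Stays prepended to a path lengthen it at no cost.\<close>

lemma reach_within_mono: "reach_within l i c \<Longrightarrow> l \<le> l' \<Longrightarrow> reach_within l' i c"
proof (induction "l' - l" arbitrary: l')
  case (Suc k)
  then obtain l'' where l'': "l' = Suc l''" "k = l'' - l" "l \<le> l''" by (cases l') auto
  then have "reach_within l'' i c" using Suc by blast
  moreover have "(0, i, 0) \<in> choices i n" by (simp add: choices_def)
  ultimately show ?case unfolding l''(1) by force
qed simp

text \<open>Splits a path at its last visit to \<open>s\<close>.\<close>

lemma reach_avoid: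
  "reach S x c \<Longrightarrow> reach (S - {s}) x c \<or> goal s \<or>
     (\<exists>a t b c'. (a, t, b) \<in> choices s n \<and> reach (S - {s}) t c' \<and> b + c' \<le> c)"
proof (induction rule: reach.induct)
  case (goal i)
  then show ?case by (cases "i = s") (auto intro: reach.goal)
next
  case (step i a t c c')
  from step.IH consider "reach (S - {s}) t c'" | "goal s"
    | a' t' b' c'' where "(a', t', b') \<in> choices s n" "reach (S - {s}) t' c''" "b' + c'' \<le> c'"
    by blast
  then show ?case
  proof cases
    case 1
    show ?thesis
    proof (cases "i = s")
      \<comment> \<open>The last visit to \<open>s\<close> is \<open>i\<close> itself, since the
        rest of the path avoids \<open>s\<close>.\<close>
      case True
      with 1 step show ?thesis by blast
    next
      case False
      with 1 step show ?thesis by (auto intro: reach.step)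
    qed
  next
    case 3
    then have "b' + c'' \<le> c + c'" by simp
    with 3 show ?thesis by blast
  qed blast
qed

text \<open>Whatever precedes the last visit to the start \<open>x\<close> is discarded; the rest
  lives in \<open>S - {x}\<close>, where the induction hypothesis applies. Costs are natural
  numbers, so discarding never makes a path dearer.\<close>

lemma reach_shorten:
  "finite S \<Longrightarrow> reach S x c \<Longrightarrow> \<exists>c' \<le> c. reach_within (card S) x c'"
proof (induction "card S" arbitrary: S x c)
  case 0
  then show ?case by (auto elim: reach.cases)
next
  case (Suc k)
  have x: "x \<in> S" using Suc.prems(2) by (auto elim: reach.cases)
  have k: "k = card (S - {x})" using Suc x by simp
  \<comment> \<open>The first state of a path must be admissible, so no path from \<open>x\<close>
    avoids \<open>x\<close>.\<close>
  have "\<not> reach (S - {x}) x c" by (auto elim: reach.cases)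
  with reach_avoid[OF Suc.prems(2), of x] consider "goal x"
    | a t b c' where "(a, t, b) \<in> choices x n" "reach (S - {x}) t c'" "b + c' \<le> c"
    by blast
  then show ?case
  proof cases
    case 1
    then have "reach_within (card S) x 0" using reach_within_mono[of 0 x 0 "card S"] by simp
    then show ?thesis by blast
  next
    case 2
    then obtain c'' where c'': "c'' \<le> c'" "reach_within k t c''"
      using Suc.hyps(1)[OF k] Suc.prems(1) k by blast
    with 2 have "reach_within (card S) x (b + c'')"
      unfolding Suc.hyps(2)[symmetric] by auto
    then show ?thesis using 2 c'' by (intro exI[of _ "b + c''"]) auto
  qed
qed

section \<open>From routings to paths\<close>

lemma walk_weight_Cons [simp]:
  "walk_weight I (v # u # vs) = weight I {v, u} + walk_weight I (u # vs)"
  unfolding walk_weight_def by (simp add: sum.lessThan_Suc_shift del: sum.lessThan_Suc)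

lemma walk_weight_single [simp]: "walk_weight I [v] = 0"
  by (simp add: walk_weight_def)

lemma walk_weight_snoc:
  "p \<noteq> [] \<Longrightarrow> walk_weight I (p @ [u]) = walk_weight I p + weight I {last p, u}"
  by (induction p rule: induct_list012) simp_all

lemma covered_foldl: "covered (foldl visit q vs) = covered q \<union> (set vs \<inter> clients I)"
  by (induction vs arbitrary: q) (auto simp: covered_visit)

lemma foldl_visit_less: "q < M \<Longrightarrow> foldl visit q vs < M"
  by (induction vs arbitrary: q) (auto simp: visit_less)

text \<open>Each edge of the walk becomes a move. A vertex is visited on arrival, so the fold runs
  over \<open>vs\<close> and leaves out the start \<open>v\<close>.\<close>

lemma reach_walk:
  assumes "walk I (v # vs)" "q < M" "j \<le> n" "d \<le> n"
    and "reach {..<N} (state (foldl visit q vs) j d (last (v # vs))) c"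
  shows "reach {..<N} (state q j d v) (walk_weight I (v # vs) + c)"
  using assms
proof (induction vs arbitrary: v q)
  case Nil
  then show ?case by simp
next
  case (Cons u vs)
  have e: "{v, u} \<in> edges I" and w: "walk I (u # vs)"
    using Cons.prems(1) unfolding walk_def by auto
  have uv: "u < n" "v < n" using edge_bounds[OF e] by auto
  have "reach {..<N} (state (visit q u) j d u) (walk_weight I (u # vs) + c)"
    using Cons.prems by (intro Cons.IH w visit_less) auto
  moreover have "(1, state (visit q u) j d u, weight I {v, u}) \<in> choices (state q j d v) n"
    using e uv Cons.prems unfolding choices_def move_def by auto
  moreover have "state q j d v \<in> {..<N}"
    using state_less Cons.prems uv by auto
  ultimately have "reach {..<N} (state q j d v) (weight I {v, u} + (walk_weight I (u # vs) + c))"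
    by (blast intro: reach.step)
  then show ?case by (simp add: add.assoc)
qed

text \<open>A departure followed by moves along a closed walk leads from one state of the form
  \<open>state q j d d\<close> to another, which closes the induction; \<open>d\<close> stands for
  the garage or the previous depot.\<close>

lemma reach_walks:
  assumes "\<forall>p \<in> set R. closed_walk I p \<and> hd p \<in> depots I" "length R \<le> j"
    and "q < M" "j \<le> n" "d \<le> n" "clients I \<subseteq> covered q \<union> \<Union> (set ` set R)"
  shows "reach {..<N} (state q j d d) (routing_weight I R)"
  using assms
proof (induction R arbitrary: q j d)
  case Nil
  then have "covered q = clients I" by (auto simp: covered_def)
  then have "goal (state q j d d)"
    using Nil covered_full_iff unfolding goal_def by simp
  then show ?case
    using Nil state_less by (auto simp: routing_weight_def intro: reach.goal)
next
  case (Cons p R)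
  then obtain v vs where p: "p = v # vs"
    unfolding closed_walk_def walk_def by (cases p) auto
  have w: "walk I (v # vs)" "last (v # vs) = v" "v \<in> depots I"
    using Cons.prems unfolding p closed_walk_def by auto
  have v: "v < n" using depots_subset w(3) by auto
  have j: "j > 0" using Cons.prems by auto
  have "clients I \<subseteq> covered (foldl visit q p) \<union> \<Union> (set ` set R)"
    using Cons.prems(6) by (auto simp: covered_foldl)
  then have "reach {..<N} (state (foldl visit q p) (j - 1) v v) (routing_weight I R)"
    using Cons.prems v by (intro Cons.IH foldl_visit_less) auto
  then have "reach {..<N} (state (visit q v) (j - 1) v v) (walk_weight I p + routing_weight I R)"
    unfolding p using w v Cons.prems by (intro reach_walk visit_less) auto
  moreover have "(2, state (visit q v) (j - 1) v v, 0) \<in> choices (state q j d d) n"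
    using v w j Cons.prems unfolding choices_def depart_def can_depart_def by auto
  moreover have "state q j d d \<in> {..<N}"
    using state_less Cons.prems by auto
  ultimately have "reach {..<N} (state q j d d) (0 + (walk_weight I p + routing_weight I R))"
    by (blast intro: reach.step)
  then show ?case by (simp add: routing_weight_def)
qed

lemma sum_list_nths_le: "(\<Sum>p \<leftarrow> nths R S. f p) \<le> (\<Sum>p \<leftarrow> R. f p :: nat)"
proof (induction R arbitrary: S)
  case (Cons p R)
  from Cons[of "{j. Suc j \<in> S}"] show ?case
    by (auto simp: nths_Cons)
qed simp

text \<open>Walks to which no client is assigned can be dropped, so \<open>n\<close> vehicles always suffice.\<close>

lemma reach_routing:
  assumes "routing I R A"
  shows "\<exists>c \<le> routing_weight I R. reach {..<N} initial c"
proof -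
  define R' where "R' = nths R (A ` clients I)"
  have "length R' \<le> card (A ` clients I)"
    unfolding R'_def length_nths by (rule card_mono) auto
  also have "\<dots> \<le> n"
    using card_image_le[of "clients I" A] card_clients_le by simp
  finally have "length R' \<le> n" .
  moreover have "length R' \<le> length R"
    unfolding R'_def length_nths by (rule order_trans[OF card_mono[of "{..<length R}"]]) auto
  ultimately have len: "length R' \<le> min (vehicles I) n"
    using assms unfolding routing_def by simp
  have sub: "set R' \<subseteq> set R"
    unfolding R'_def by (rule set_nths_subset)
  have "clients I \<subseteq> \<Union> (set ` set R')"
    using assms unfolding routing_def R'_def set_nths by blast
  then have "reach {..<N} initial (routing_weight I R')"
    unfolding initial_def using len sub assms
    by (intro reach_walks) (auto simp: routing_def)
  then show ?thesis
    using sum_list_nths_le unfolding R'_def routing_weight_def by blast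
qed

section \<open>The table of least costs\<close>

text \<open>Here and in the table below, \<open>0\<close> encodes an infinite cost and \<open>c + 1\<close> the cost \<open>c\<close>.\<close>

definition best :: "(nat \<Rightarrow> nat) \<Rightarrow> (nat \<times> nat \<times> nat) set \<Rightarrow> nat \<Rightarrow> nat \<Rightarrow> nat \<Rightarrow> bool" where
  "best G Ch f a t \<longleftrightarrow>
     (f \<noteq> 0 \<longrightarrow> (\<exists>c. (a, t, c) \<in> Ch \<and> G t \<noteq> 0 \<and> f = G t + c)) \<and>
     (\<forall>a' t' c'. (a', t', c') \<in> Ch \<longrightarrow> G t' \<noteq> 0 \<longrightarrow> 0 < f \<and> f \<le> G t' + c')"

text \<open>With no vertex offered yet only the stay remains, so minimisation starts by copying the
  entry of the previous layer.\<close>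

lemma best_stay: "best G (choices i 0) (G i) 0 i"
  by (auto simp: best_def choices_def)

text \<open>Adding \<open>c'\<close> keeps the offset of the encoding, so encoded costs are compared
  directly and only 0 needs a separate test.\<close>

lemma best_improve:
  "best G Ch f a t \<Longrightarrow> G t' \<noteq> 0 \<Longrightarrow> f = 0 \<or> G t' + c' < f \<Longrightarrow>
    best G (insert (a', t', c') Ch) (G t' + c') a' t'"
  unfolding best_def by fastforce

lemma best_keep:
  "best G Ch f a t \<Longrightarrow> G t' = 0 \<or> f \<noteq> 0 \<and> f \<le> G t' + c' \<Longrightarrow>
    best G (insert (a', t', c') Ch) f a t"
  unfolding best_def by auto

lemma best_cong:
  assumes "best G Ch f a t" "\<And>a t c. (a, t, c) \<in> Ch \<Longrightarrow> G t = G' t"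
  shows "best G' Ch f a t"
  using assms unfolding best_def by metis

lemma choices_Suc:
  "choices i (Suc u) =
    (if can_depart i u then insert (2, depart i u, 0) else id)
    ((if {pos i, u} \<in> edges I then insert (1, move i u, weight I {pos i, u}) else id) (choices i u))"
  unfolding choices_def by (auto simp: less_Suc_eq)

text \<open>
  Entry \<open>l * N + i\<close> of \<open>F\<close> is \<open>1 + c\<close> if \<open>c\<close> is the least cost of reaching a goal from \<open>i\<close> in at
  most \<open>l\<close> steps, and \<open>0\<close> if no goal can be reached; \<open>A\<close> and \<open>T\<close> record an optimal first step.
\<close>

definition table :: "(nat \<Rightarrow> nat) \<Rightarrow> (nat \<Rightarrow> nat) \<Rightarrow> (nat \<Rightarrow> nat) \<Rightarrow> nat \<Rightarrow> bool" where
  "table F A T L \<longleftrightarrow>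
     (\<forall>i<N. F i = of_bool (goal i)) \<and>
     (\<forall>l<L. \<forall>i<N. best (\<lambda>t. F (l * N + t)) (choices i n)
        (F (Suc l * N + i)) (A (Suc l * N + i)) (T (Suc l * N + i)))"

text \<open>An entry is at most the entry behind any choice plus the cost of that choice, so along a
  path it stays below the encoded path cost. This is the half of optimality that speaks about all
  routings.\<close>

lemma table_complete:
  assumes "table F A T L"
  shows "l \<le> L \<Longrightarrow> i < N \<Longrightarrow> reach_within l i c \<Longrightarrow> 0 < F (l * N + i) \<and> F (l * N + i) \<le> Suc c"
proof (induction l arbitrary: i c)
  case 0
  then show ?case using assms by (simp add: table_def)
next
  case (Suc l)
  then obtain a t b c' where
    t: "(a, t, b) \<in> choices i n" "reach_within l t c'" "c = b + c'" by auto
  have "0 < F (l * N + t) \<and> F (l * N + t) \<le> Suc c'"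
    using Suc t choices_less by auto
  moreover have "best (\<lambda>t. F (l * N + t)) (choices i n)
        (F (Suc l * N + i)) (A (Suc l * N + i)) (T (Suc l * N + i))"
    using assms Suc.prems unfolding table_def by (simp del: mult_Suc)
  ultimately have "0 < F (Suc l * N + i) \<and> F (Suc l * N + i) \<le> F (l * N + t) + b"
    using t(1) unfolding best_def by (metis gr_implies_not0)
  with t \<open>0 < F (l * N + t) \<and> F (l * N + t) \<le> Suc c'\<close> show ?case by linarith
qed

lemma table_optimal:
  assumes "table F A T N" "routing I R B"
  shows "0 < F (N * N + initial) \<and> F (N * N + initial) \<le> Suc (routing_weight I R)"
proof -
  obtain c where c: "c \<le> routing_weight I R" "reach {..<N} initial c"
    using reach_routing[OF assms(2)] by blast
  then obtain c' where "c' \<le> c" "reach_within N initial c'"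
    using reach_shorten[of "{..<N}" initial c] by auto
  then show ?thesis
    using table_complete[OF assms(1) order_refl initial_less, of c'] c(1) by linarith
qed

lemma table_extend:
  assumes "table F A T L"
    and same: "\<And>y. y < Suc L * N \<Longrightarrow> F' y = F y \<and> A' y = A y \<and> T' y = T y"
    and new: "\<And>i. i < N \<Longrightarrow> best (\<lambda>t. F (L * N + t)) (choices i n)
      (F' (Suc L * N + i)) (A' (Suc L * N + i)) (T' (Suc L * N + i))"
  shows "table F' A' T' (Suc L)"
  unfolding table_def
proof (intro conjI allI impI)
  fix i assume "i < N"
  then show "F' i = of_bool (goal i)"
    using assms(1) same[of i] unfolding table_def by simp
next
  fix l i assume l: "l < Suc L" and i: "i < N"
  \<comment> \<open>Layers up to \<open>L\<close> end before the index \<open>Suc L * N\<close>,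
    where the new layer starts.\<close>
  have bnd: "l' * N + t < Suc L * N" if "l' \<le> L" "t < N" for l' t
  proof -
    have "l' * N + t < Suc l' * N" using that by simp
    also have "\<dots> \<le> Suc L * N" using that by (intro mult_le_mono) auto
    finally show ?thesis .
  qed
  have "best (\<lambda>t. F (l * N + t)) (choices i n)
      (F' (Suc l * N + i)) (A' (Suc l * N + i)) (T' (Suc l * N + i))"
  proof (cases "l = L")
    case True
    then show ?thesis using new[OF i] by simp
  next
    case False
    then show ?thesis
      using l i assms(1) same[OF bnd[of "Suc l" i]] unfolding table_def by (simp del: mult_Suc)
  qed
  then show "best (\<lambda>t. F' (l * N + t)) (choices i n)
      (F' (Suc l * N + i)) (A' (Suc l * N + i)) (T' (Suc l * N + i))"
    by (rule best_cong) (use same bnd l i choices_less in auto)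
qed

section \<open>From paths back to routings\<close>

text \<open>\<open>Ws\<close> are the walks emitted on the way to state \<open>i\<close>; all but the last one are finished.\<close>

definition partial :: "nat \<Rightarrow> nat list list \<Rightarrow> (nat \<Rightarrow> nat) \<Rightarrow> bool" where
  "partial i Ws A \<longleftrightarrow>
     visited i < M \<and> length Ws + spare i = min (vehicles I) n \<and>
     (Ws = [] \<longrightarrow> pos i = n) \<and>
     (Ws \<noteq> [] \<longrightarrow> walk I (last Ws) \<and> hd (last Ws) = home i \<and> last (last Ws) = pos i \<and>
        home i \<in> depots I) \<and>
     (\<forall>p \<in> set (butlast Ws). closed_walk I p \<and> hd p \<in> depots I) \<and>
     covered (visited i) \<subseteq> \<Union> (set ` set Ws) \<and>
     (\<forall>u \<in> \<Union> (set ` set Ws). A u < length Ws \<and> u \<in> set (Ws ! A u))"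

lemma partial_initial: "partial initial [] A"
  unfolding partial_def initial_def by simp

text \<open>The garage \<open>n\<close> is no endpoint of an edge, so there is a current walk to
  extend. Reassigning \<open>u\<close> to it is harmless, as \<open>u\<close> now lies on
  it.\<close>

lemma partial_extend:
  assumes "partial i Ws A" "{pos i, u} \<in> edges I"
  defines "Ws' \<equiv> butlast Ws @ [last Ws @ [u]]"
  shows "Ws \<noteq> []" "partial (move i u) Ws' (A(u := length Ws - 1))"
    "routing_weight I Ws' = routing_weight I Ws + weight I {pos i, u}"
proof -
  have u: "u < n" "pos i < n" using edge_bounds[OF assms(2)] by auto
  then show ne: "Ws \<noteq> []" using assms(1) unfolding partial_def by auto
  then obtain Vs p where Ws: "Ws = Vs @ [p]" by (metis append_butlast_last_id)
  have W': "Ws' = Vs @ [p @ [u]]" unfolding Ws'_def Ws by simp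
  have p: "walk I p" "hd p = home i" "last p = pos i" "home i \<in> depots I" and pne: "p \<noteq> []"
    using assms(1) unfolding partial_def Ws walk_def by auto
  have "walk I (p @ [u])"
    using p(1,3) u pne assms(2) verts unfolding walk_def by (auto simp: successively_append_iff)
  moreover have "(A(u := length Ws - 1)) x < length Ws' \<and> x \<in> set (Ws' ! (A(u := length Ws - 1)) x)"
    if "x \<in> \<Union> (set ` set Ws')" for x
  proof (cases "x = u")
    case True
    then show ?thesis unfolding W' Ws by simp
  next
    case False
    then have "x \<in> \<Union> (set ` set Ws)" using that unfolding W' Ws by auto
    then have "A x < length Ws" "x \<in> set (Ws ! A x)" using assms(1) unfolding partial_def by blast+
    then show ?thesis using False unfolding W' Ws by (auto simp: nth_append)
  qed
  ultimately show "partial (move i u) Ws' (A(u := length Ws - 1))"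
    using assms(1) u p pne unfolding partial_def move_def W' Ws
    by (auto simp: covered_visit visit_less)
  show "routing_weight I Ws' = routing_weight I Ws + weight I {pos i, u}"
    unfolding W' Ws routing_weight_def using pne p by (simp add: walk_weight_snoc)
qed

text \<open>A departure requires the vehicle to be at its depot, which closes the last walk; the
  vehicle spent balances the walk added.\<close>

lemma partial_depart:
  assumes "partial i Ws A" "can_depart i u"
  shows "partial (depart i u) (Ws @ [[u]]) (A(u := length Ws))"
    "routing_weight I (Ws @ [[u]]) = routing_weight I Ws"
proof -
  have u: "u < n" "u \<in> depots I" using assms(2) depots_subset unfolding can_depart_def by auto
  have "(A(u := length Ws)) x < length (Ws @ [[u]]) \<and>
      x \<in> set ((Ws @ [[u]]) ! (A(u := length Ws)) x)"
    if "x \<in> \<Union> (set ` set (Ws @ [[u]]))" for x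
  proof (cases "x = u")
    case False
    then have "x \<in> \<Union> (set ` set Ws)" using that by auto
    then have "A x < length Ws" "x \<in> set (Ws ! A x)" using assms(1) unfolding partial_def by blast+
    then show ?thesis using False by (auto simp: nth_append)
  qed simp
  moreover have "closed_walk I p \<and> hd p \<in> depots I" if "p \<in> set Ws" for p
  proof -
    from that obtain Vs r where "Ws = Vs @ [r]" by (metis append_butlast_last_id empty_iff empty_set)
    then show ?thesis
      using that assms unfolding partial_def can_depart_def closed_walk_def by auto
  qed
  moreover have "walk I [u]" using u verts unfolding walk_def by simp
  moreover have "spare i - 1 \<le> n" using components_le(3)[of i] by linarith
  moreover have "length Ws + spare i = min (vehicles I) n" "spare i > 0"
    using assms unfolding partial_def can_depart_def by auto
  ultimately show "partial (depart i u) (Ws @ [[u]]) (A(u := length Ws))"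
    using assms(1) u unfolding partial_def depart_def
    by (auto simp: covered_visit visit_less)
  show "routing_weight I (Ws @ [[u]]) = routing_weight I Ws"
    unfolding routing_weight_def by simp
qed

text \<open>Being back home closes the last walk, and the full mask puts every client on an emitted
  walk, to which \<open>A\<close> already assigns it.\<close>

lemma partial_goal:
  assumes "partial i Ws A" "goal i"
  shows "routing I Ws A"
proof -
  have "clients I = covered (visited i)"
    using assms covered_full_iff[of "visited i"] unfolding partial_def goal_def by blast
  moreover have "closed_walk I p \<and> hd p \<in> depots I" if "p \<in> set Ws" for p
  proof -
    from that obtain Vs r where "Ws = Vs @ [r]" by (metis append_butlast_last_id empty_iff empty_set)
    then show ?thesis
      using that assms unfolding partial_def goal_def closed_walk_def by auto
  qed
  ultimately show ?thesis
    using assms(1) unfolding partial_def routing_def by auto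
qed

end

section \<open>The program\<close>

text \<open>\<open>M\<close> doubles once per client. The three loops of additions each multiply by
  \<open>n + 1\<close>, and \<open>N\<close> is the last product.\<close>

definition prog_sizes :: com where
  "prog_sizes = block
    [Assign ''n1'' (Plus (Var ''n'') (Const 1)),
     Assign ''M'' (Const 1),
     For ''v'' ''n'' (If (Cell ''C'' (Var ''v'')) (Assign ''M'' (Plus (Var ''M'') (Var ''M''))) Skip),
     For ''v'' ''n1'' (Assign ''N1'' (Plus (Var ''N1'') (Var ''M''))),
     For ''v'' ''n1'' (Assign ''N2'' (Plus (Var ''N2'') (Var ''N1''))),
     For ''v'' ''n1'' (Assign ''N'' (Plus (Var ''N'') (Var ''N2'')))]"

text \<open>Multiplication and division by \<open>n + 1\<close> and \<open>n\<close> are not machine operations, hence the tables.\<close>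

definition prog_tables :: com where
  "prog_tables = For ''x'' ''N'' (block
    [Store ''mu'' (Plus (Var ''x'') (Const 1)) (Plus (Cell ''mu'' (Var ''x'')) (Var ''n1'')),
     Store ''mn'' (Plus (Var ''x'') (Const 1)) (Plus (Cell ''mn'' (Var ''x'')) (Var ''n'')),
     If (Minus (Var ''n'') (Cell ''md'' (Var ''x'')))
      (block [Store ''md'' (Plus (Var ''x'') (Const 1)) (Plus (Cell ''md'' (Var ''x'')) (Const 1)),
              Store ''dv'' (Plus (Var ''x'') (Const 1)) (Cell ''dv'' (Var ''x''))])
      (block [Store ''md'' (Plus (Var ''x'') (Const 1)) (Const 0),
              Store ''dv'' (Plus (Var ''x'') (Const 1)) (Plus (Cell ''dv'' (Var ''x'')) (Const 1))])])"

text \<open>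
  Bit \<open>r\<close> of \<open>q\<close>, without division: \<open>p = 2^r\<close> is gained below \<open>p\<close> and nothing between \<open>p\<close> and
  \<open>p2 = 2 p\<close>; from there on the pattern has period \<open>p2\<close>.
\<close>

definition prog_gain_row :: com where
  "prog_gain_row = For ''q'' ''M''
    (If (Minus (Var ''p'') (Var ''q''))
      (Store ''gain'' (Plus (Cell ''mu'' (Var ''q'')) (Var ''v'')) (Var ''p''))
      (If (Minus (Var ''p2'') (Var ''q'')) Skip
        (Store ''gain'' (Plus (Cell ''mu'' (Var ''q'')) (Var ''v''))
          (Cell ''gain'' (Plus (Cell ''mu'' (Minus (Var ''q'') (Var ''p2''))) (Var ''v''))))))"

definition prog_gain :: com where
  "prog_gain = block
    [Assign ''p'' (Const 1),
     For ''v'' ''n'' (If (Cell ''C'' (Var ''v''))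
      (block [Assign ''p2'' (Plus (Var ''p'') (Var ''p'')), prog_gain_row, Assign ''p'' (Var ''p2'')])
      Skip)]"

abbreviation "pos_exp \<equiv> Cell ''md'' (Var ''i'')"
abbreviation "home_exp \<equiv> Cell ''md'' (Cell ''dv'' (Var ''i''))"
abbreviation "spare_exp \<equiv> Cell ''md'' (Cell ''dv'' (Cell ''dv'' (Var ''i'')))"
abbreviation "visited_exp \<equiv> Cell ''dv'' (Cell ''dv'' (Cell ''dv'' (Var ''i'')))"

definition differ :: "exp \<Rightarrow> exp \<Rightarrow> exp" where
  "differ e f = Plus (Minus e f) (Minus f e)"

definition state_exp :: "exp \<Rightarrow> exp \<Rightarrow> exp \<Rightarrow> exp \<Rightarrow> exp" where
  "state_exp q j d v =
    Plus (Cell ''mu'' (Plus (Cell ''mu'' (Plus (Cell ''mu'' q) j)) d)) v"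

lemma val_differ [simp]: "val (differ e f) s \<noteq> 0 \<longleftrightarrow> val e s \<noteq> val f s"
  "val (differ e f) s = 0 \<longleftrightarrow> val e s = val f s"
  by (auto simp: differ_def)

definition prog_base :: com where
  "prog_base = For ''i'' ''N''
    (If (differ pos_exp home_exp) Skip
      (If (differ visited_exp (Minus (Var ''M'') (Const 1))) Skip
        (Store ''F'' (Var ''i'') (Const 1))))"

text \<open>In the inner guard the first summand is nonzero if the stored cost is infinite, the
  second if the offer is strictly cheaper.\<close>

definition prog_relax :: com where
  "prog_relax =
    If (Cell ''F'' (Plus (Var ''base'') (Var ''t'')))
     (If (Plus (Minus (Const 1) (Cell ''F'' (Var ''x'')))
           (Minus (Cell ''F'' (Var ''x''))
             (Plus (Cell ''F'' (Plus (Var ''base'') (Var ''t''))) (Var ''c''))))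
       (block
         [Store ''F'' (Var ''x'') (Plus (Cell ''F'' (Plus (Var ''base'') (Var ''t''))) (Var ''c'')),
          Store ''ac'' (Var ''x'') (Var ''a''),
          Store ''nx'' (Var ''x'') (Var ''t'')])
       Skip)
     Skip"

definition prog_choice :: com where
  "prog_choice = block
    [Assign ''q'' (Plus visited_exp (Cell ''gain'' (Plus (Cell ''mu'' visited_exp) (Var ''u'')))),
     If (Cell ''adj'' (Plus (Cell ''mn'' pos_exp) (Var ''u'')))
      (block
        [Assign ''t'' (state_exp (Var ''q'') spare_exp home_exp (Var ''u'')),
         Assign ''c'' (Cell ''w'' (Plus (Cell ''mn'' pos_exp) (Var ''u''))),
         Assign ''a'' (Const 1),
         prog_relax])
      Skip,
     If (Cell ''D'' (Var ''u''))
      (If spare_exp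
        (If (differ pos_exp home_exp) Skip
          (block
            [Assign ''t'' (state_exp (Var ''q'') (Minus spare_exp (Const 1)) (Var ''u'') (Var ''u'')),
             Assign ''c'' (Const 0),
             Assign ''a'' (Const 2),
             prog_relax]))
        Skip)
      Skip]"

definition prog_state :: com where
  "prog_state = block
    [Assign ''x'' (Plus (Var ''cur'') (Var ''i'')),
     Store ''F'' (Var ''x'') (Cell ''F'' (Plus (Var ''base'') (Var ''i''))),
     Store ''ac'' (Var ''x'') (Const 0),
     Store ''nx'' (Var ''x'') (Var ''i''),
     For ''u'' ''n'' prog_choice]"

definition prog_layer :: com where
  "prog_layer = block
    [Assign ''cur'' (Plus (Var ''base'') (Var ''N'')),
     For ''i'' ''N'' prog_state,
     Assign ''base'' (Var ''cur'')]"

definition prog_layers :: com where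
  "prog_layers = block [Assign ''base'' (Const 0), For ''l'' ''N'' prog_layer]"

text \<open>Actions 1 (extend) and 2 (new walk) are told apart by subtracting 1. The value stored in
  \<open>start\<close> is the end of the current walk and at the same time the start of the
  next.\<close>

definition prog_emit :: com where
  "prog_emit = block
    [Assign ''x'' (Plus (Var ''base'') (Var ''i'')),
     If (Cell ''ac'' (Var ''x''))
      (block
        [Assign ''u'' (Cell ''md'' (Cell ''nx'' (Var ''x''))),
         If (Minus (Cell ''ac'' (Var ''x'')) (Const 1))
          (Assign ''count'' (Plus (Var ''count'') (Const 1))) Skip,
         Store ''walk'' (Var ''len'') (Var ''u''),
         Assign ''len'' (Plus (Var ''len'') (Const 1)),
         Store ''start'' (Var ''count'') (Var ''len''),
         Store ''assign'' (Var ''u'') (Minus (Var ''count'') (Const 1))])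
      Skip,
     Assign ''i'' (Cell ''nx'' (Var ''x'')),
     Assign ''base'' (Minus (Var ''base'') (Var ''N''))]"

text \<open>The double subtraction computes \<open>min n k\<close>.\<close>

definition prog_trace :: com where
  "prog_trace = block
    [Assign ''i'' (state_exp (Const 0) (Minus (Var ''n'') (Minus (Var ''n'') (Var ''k'')))
       (Var ''n'') (Var ''n'')),
     If (Cell ''F'' (Plus (Var ''base'') (Var ''i'')))
      (block [Assign ''feasible'' (Const 1), For ''l'' ''N'' prog_emit])
      Skip]"

definition prog :: com where
  "prog = block [prog_sizes, prog_tables, prog_gain, prog_base, prog_layers, prog_trace]"

lemma mods_progs [simp]:
  "mods prog_sizes = {''n1'', ''M'', ''v'', ''N1'', ''N2'', ''N''}"
  "mods prog_tables = {''x'', ''mu'', ''mn'', ''md'', ''dv''}"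
  "mods prog_gain_row = {''q'', ''gain''}"
  "mods prog_gain = {''p'', ''v'', ''p2'', ''q'', ''gain''}"
  "mods prog_base = {''i'', ''F''}"
  "mods prog_relax = {''F'', ''ac'', ''nx''}"
  "mods prog_choice = {''q'', ''t'', ''c'', ''a'', ''F'', ''ac'', ''nx''}"
  "mods prog_state = {''x'', ''u'', ''q'', ''t'', ''c'', ''a'', ''F'', ''ac'', ''nx''}"
  "mods prog_layer = {''cur'', ''base'', ''i'', ''x'', ''u'', ''q'', ''t'', ''c'', ''a'', ''F'', ''ac'', ''nx''}"
  "mods prog_layers = {''l'', ''cur'', ''base'', ''i'', ''x'', ''u'', ''q'', ''t'', ''c'', ''a'', ''F'', ''ac'', ''nx''}"
  "mods prog_emit = {''x'', ''u'', ''count'', ''walk'', ''len'', ''start'', ''assign'', ''i'', ''base''}"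
  by (auto simp: prog_sizes_def prog_tables_def prog_gain_row_def prog_gain_def prog_base_def
      prog_relax_def prog_choice_def prog_state_def prog_layer_def prog_layers_def prog_emit_def)

section \<open>Correctness of preprocessing and of the table computation\<close>

context numbered_vrp
begin

text \<open>The range \<open>v \<le> n\<close> includes the garage: row \<open>n\<close> lies past
  the matrix and reads 0, so the edge test is also right for a vehicle that has not
  departed.\<close>

definition input_ok :: "memory \<Rightarrow> bool" where
  "input_ok s \<longleftrightarrow> s ''n'' 0 = n \<and> s ''k'' 0 = vehicles I \<and>
     (\<forall>v\<le>n. \<forall>u<n. s ''adj'' (v * n + u) = of_bool ({v, u} \<in> edges I) \<and>
        ({v, u} \<in> edges I \<longrightarrow> s ''w'' (v * n + u) = weight I {v, u})) \<and>
     (\<forall>u. s ''D'' u = of_bool (u \<in> depots I)) \<and>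
     (\<forall>u. s ''C'' u = of_bool (u \<in> clients I))"

definition sizes_ok :: "memory \<Rightarrow> bool" where
  "sizes_ok s \<longleftrightarrow> s ''n1'' 0 = n + 1 \<and> s ''M'' 0 = M \<and> s ''N'' 0 = N"

text \<open>The bound is inclusive because iteration \<open>x\<close> fills entry
  \<open>x + 1\<close>.\<close>

definition tables_upto :: "nat \<Rightarrow> memory \<Rightarrow> bool" where
  "tables_upto m s \<longleftrightarrow> (\<forall>x\<le>m. s ''mu'' x = x * (n + 1) \<and> s ''mn'' x = x * n \<and>
     s ''md'' x = x mod (n + 1) \<and> s ''dv'' x = x div (n + 1))"

definition gain_ok :: "memory \<Rightarrow> bool" where
  "gain_ok s \<longleftrightarrow> (\<forall>q<M. \<forall>v<n. s ''gain'' (q * (n + 1) + v) = gain q v)"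

text \<open>What preprocessing leaves behind; no later phase writes to these arrays.\<close>

definition static :: "memory \<Rightarrow> bool" where
  "static s \<longleftrightarrow> input_ok s \<and> sizes_ok s \<and> tables_upto N s \<and> gain_ok s"

lemma static_cong:
  assumes "static s"
    "\<And>y. y \<in> {''n'', ''k'', ''adj'', ''w'', ''D'', ''C'', ''n1'', ''M'', ''N'', ''mu'', ''mn'', ''md'', ''dv'', ''gain''}
      \<Longrightarrow> t y = s y"
  shows "static t"
  using assms(1) by (simp add: static_def input_ok_def sizes_ok_def tables_upto_def gain_ok_def assms(2))

lemma input_memory_ok: "input_ok (input_memory I)"
proof -
  have c: "card (verts I) = n" using verts by simp
  have "v * n + u < n * n \<longleftrightarrow> v < n" if "u < n" for u v
  proof
    assume "v < n"
    then have "Suc v * n \<le> n * n" by (intro mult_le_mono) auto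
    with that show "v * n + u < n * n" by simp
  next
    assume "v * n + u < n * n"
    then show "v < n" using mult_le_mono1[of n v n] by linarith
  qed
  moreover have "{v, u} \<in> edges I \<Longrightarrow> v < n" for u v using edge_bounds by blast
  ultimately show ?thesis
    unfolding input_ok_def input_memory_def Let_def c by auto
qed

lemma n_le_N: "n + 1 \<le> N" and M_le_N: "M \<le> N"
proof -
  have "1 * 1 * 1 * (n + 1) \<le> M * (n + 1) * (n + 1) * (n + 1)"
    using M_pos by (intro mult_le_mono) (auto simp: Suc_le_eq)
  then show "n + 1 \<le> N" by (simp add: N_def)
  have "M * 1 * 1 * 1 \<le> M * (n + 1) * (n + 1) * (n + 1)"
    by (intro mult_le_mono) auto
  then show "M \<le> N" by (simp add: N_def)
qed

lemma rank_Suc: "rank (Suc v) = rank v + of_bool (v \<in> clients I)"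
proof -
  have "clients I \<inter> {..<Suc v} = (if v \<in> clients I then insert v else id) (clients I \<inter> {..<v})"
    by (auto simp: less_Suc_eq)
  then show ?thesis by (simp add: rank_def)
qed

lemma rank_n: "rank n = card (clients I)"
  using clients_subset unfolding rank_def by (simp add: Int_absorb2)

lemma runs_sizes:
  assumes "input_ok s" "s ''N1'' 0 = 0" "s ''N2'' 0 = 0" "s ''N'' 0 = 0"
  shows "runs N prog_sizes s sizes_ok"
proof -
  \<comment> \<open>Multiplication by \<open>n + 1\<close> as repeated addition onto a cell that
    starts at 0.\<close>
  have add_loop: "runs N (For ''v'' ''n1'' (Assign y (Plus (Var y) (Var z)))) t Q"
    if "t ''n1'' 0 = n + 1" "t y 0 = 0" "y \<noteq> ''v''" "y \<noteq> ''n1''" "y \<noteq> z" "z \<noteq> ''v''"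
      "\<And>t'. (\<And>x. x \<notin> {''v'', y} \<Longrightarrow> t' x = t x) \<Longrightarrow> t' y 0 = t z 0 * (n + 1) \<Longrightarrow> Q t'"
    for t y z Q
    using that n_le_N
    by (intro runs_For[where K = "n + 1" and Inv = "\<lambda>i t'. t' y 0 = t z 0 * i"] runs_intros) auto
  have M_loop: "runs N (For ''v'' ''n''
      (If (Cell ''C'' (Var ''v'')) (Assign ''M'' (Plus (Var ''M'') (Var ''M''))) Skip)) t Q"
    if t: "t ''n'' 0 = n" "t ''M'' 0 = 1" "t ''C'' = s ''C''"
      and Q: "\<And>t'. (\<And>x. x \<notin> {''v'', ''M''} \<Longrightarrow> t' x = t x) \<Longrightarrow> t' ''M'' 0 = M \<Longrightarrow> Q t'"
    for t Q
  proof (rule runs_For[where K = n and Inv = "\<lambda>i t. t ''M'' 0 = 2 ^ rank i"])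
    fix j t'
    assume fr: "\<And>y. y \<notin> insert ''v'' (mods (If (Cell ''C'' (Var ''v''))
        (Assign ''M'' (Plus (Var ''M'') (Var ''M''))) Skip)) \<Longrightarrow> t' y = t y"
      and j: "t' ''v'' 0 = j" "t' ''M'' 0 = 2 ^ rank j"
    have "t' ''C'' j = of_bool (j \<in> clients I)"
      using fr[of "''C''"] t(3) assms(1) unfolding input_ok_def by simp
    with j show "runs N (If (Cell ''C'' (Var ''v'')) (Assign ''M'' (Plus (Var ''M'') (Var ''M''))) Skip) t'
        (\<lambda>t. t ''M'' 0 = 2 ^ rank (Suc j))"
      by (intro runs_intros) (auto simp: rank_Suc)
  qed (use t Q n_le_N in \<open>auto simp: M_def rank_n\<close>, simp add: rank_def)
  show ?thesis
    unfolding prog_sizes_def block.simps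
    by (intro runs_Seq runs_Store M_loop add_loop)
      (use assms in \<open>simp_all add: input_ok_def sizes_ok_def N_def\<close>)
qed

lemma runs_tables:
  assumes "input_ok s" "sizes_ok s" "s ''mu'' 0 = 0" "s ''mn'' 0 = 0" "s ''md'' 0 = 0" "s ''dv'' 0 = 0"
  shows "runs N prog_tables s (tables_upto N)"
  unfolding prog_tables_def
proof (rule runs_For[where K = N and Inv = tables_upto])
  let ?body = "block
    [Store ''mu'' (Plus (Var ''x'') (Const 1)) (Plus (Cell ''mu'' (Var ''x'')) (Var ''n1'')),
     Store ''mn'' (Plus (Var ''x'') (Const 1)) (Plus (Cell ''mn'' (Var ''x'')) (Var ''n'')),
     If (Minus (Var ''n'') (Cell ''md'' (Var ''x'')))
      (block [Store ''md'' (Plus (Var ''x'') (Const 1)) (Plus (Cell ''md'' (Var ''x'')) (Const 1)),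
              Store ''dv'' (Plus (Var ''x'') (Const 1)) (Cell ''dv'' (Var ''x''))])
      (block [Store ''md'' (Plus (Var ''x'') (Const 1)) (Const 0),
              Store ''dv'' (Plus (Var ''x'') (Const 1)) (Plus (Cell ''dv'' (Var ''x'')) (Const 1))])]"
  fix j t
  assume j: "j < N" "t ''x'' 0 = j" "tables_upto j t"
    and fr: "\<And>y. y \<notin> insert ''x'' (mods ?body)
      \<Longrightarrow> t y = s y"
  have n: "t ''n1'' 0 = Suc n" "t ''n'' 0 = n"
    using fr[of "''n1''"] fr[of "''n''"] assms(1,2) unfolding input_ok_def sizes_ok_def by simp_all
  \<comment> \<open>Counting up, the remainder wraps around at \<open>n\<close>, and exactly then
    the quotient advances.\<close>
  have le: "j mod Suc n = n \<or> j mod Suc n < n"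
    using mod_less_divisor[of "Suc n" j] by linarith
  show "runs N ?body t (tables_upto (Suc j))"
    unfolding block.simps
    by (intro runs_intros)
      (use j n le in \<open>auto simp: tables_upto_def le_Suc_eq mod_Suc div_Suc\<close>)
qed (use assms in \<open>auto simp: tables_upto_def sizes_ok_def\<close>)

text \<open>Uniqueness of digits in base \<open>n + 1\<close>: a store into one row and column of
  \<open>gain\<close> touches no other entry.\<close>

lemma index_eq_iff:
  "u \<le> n \<Longrightarrow> v \<le> n \<Longrightarrow> q * (n + 1) + u = q' * (n + 1) + v \<longleftrightarrow> q = q' \<and> u = v"
proof
  assume uv: "u \<le> n" "v \<le> n" and eq: "q * (n + 1) + u = q' * (n + 1) + v"
  have "(q * (n + 1) + u) div (n + 1) = q" "(q' * (n + 1) + v) div (n + 1) = q'"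
    using uv by (simp_all del: mult_Suc_right add: div_mult_self3)
  with eq show "q = q' \<and> u = v" by simp
qed simp

lemma gain_simps:
  assumes "v \<in> clients I"
  shows "q < 2 ^ rank v \<Longrightarrow> gain q v = 2 ^ rank v"
    "2 ^ rank v \<le> q \<Longrightarrow> q < 2 * 2 ^ rank v \<Longrightarrow> gain q v = 0"
    "2 * 2 ^ rank v \<le> q \<Longrightarrow> gain q v = gain (q - 2 * 2 ^ rank v) v"
proof -
  define p :: nat where "p = 2 ^ rank v"
  have p: "p > 0" by (simp add: p_def)
  show "q < 2 ^ rank v \<Longrightarrow> gain q v = 2 ^ rank v"
    using assms by (simp add: gain_def)
  show "gain q v = 0" if "2 ^ rank v \<le> q" "q < 2 * 2 ^ rank v"
  proof -
    have "q div p = 1"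
      using that p unfolding p_def[symmetric] by (intro div_nat_eqI) auto
    then show ?thesis unfolding gain_def p_def by simp
  qed
  show "gain q v = gain (q - 2 * 2 ^ rank v) v" if "2 * 2 ^ rank v \<le> q"
  proof -
    have "2 * p \<le> q" using that unfolding p_def .
    then have "q = (q - 2 * p) + p * 2" by simp
    then obtain r where "q = r + p * 2" by blast
    then show ?thesis using p unfolding gain_def p_def[symmetric] by simp
  qed
qed

lemma runs_gain_row:
  assumes s: "s ''M'' 0 = M" "tables_upto N s" "s ''p'' 0 = 2 ^ rank v" "s ''p2'' 0 = 2 * 2 ^ rank v"
      "s ''v'' 0 = v"
    and v: "v < n" "v \<in> clients I"
    and pre: "\<forall>q<M. \<forall>u<n. s ''gain'' (q * (n + 1) + u) = (if u < v then gain q u else 0)"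
  shows "runs N prog_gain_row s
    (\<lambda>t. \<forall>q<M. \<forall>u<n. t ''gain'' (q * (n + 1) + u) = (if u < Suc v then gain q u else 0))"
  unfolding prog_gain_row_def
proof (rule runs_For[where K = M and Inv = "\<lambda>r t. \<forall>q<M. \<forall>u<n.
    t ''gain'' (q * (n + 1) + u) = (if u < v \<or> u = v \<and> q < r then gain q u else 0)"])
  let ?body = "If (Minus (Var ''p'') (Var ''q''))
      (Store ''gain'' (Plus (Cell ''mu'' (Var ''q'')) (Var ''v'')) (Var ''p''))
      (If (Minus (Var ''p2'') (Var ''q'')) Skip
        (Store ''gain'' (Plus (Cell ''mu'' (Var ''q'')) (Var ''v''))
          (Cell ''gain'' (Plus (Cell ''mu'' (Minus (Var ''q'') (Var ''p2''))) (Var ''v'')))))"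
  fix j t
  assume j: "j < M" "t ''q'' 0 = j" and inv: "\<forall>q<M. \<forall>u<n.
    t ''gain'' (q * (n + 1) + u) = (if u < v \<or> u = v \<and> q < j then gain q u else 0)"
    and fr: "\<And>y. y \<notin> insert ''q'' (mods ?body) \<Longrightarrow> t y = s y"
  have [simp]: "t ''p'' 0 = 2 ^ rank v" "t ''p2'' 0 = 2 * 2 ^ rank v" "t ''v'' 0 = v" "t ''mu'' = s ''mu''"
    using s fr[of "''p''"] fr[of "''p2''"] fr[of "''v''"] fr[of "''mu''"] by simp_all
  have mu: "s ''mu'' x = x * (n + 1)" if "x \<le> j" for x
    using s(2) that j M_le_N unfolding tables_upto_def by auto
  \<comment> \<open>The row that is read comes strictly before row \<open>j\<close>, so its entry is
    already final.\<close>
  have gain: "t ''gain'' ((j - 2 * 2 ^ rank v) * (n + 1) + v) = gain j v" if "2 * 2 ^ rank v \<le> j"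
  proof -
    have "(0::nat) < 2 ^ rank v" by simp
    then have "j - 2 * 2 ^ rank v < j" using that by linarith
    then show ?thesis using inv v j gain_simps(3)[OF v(2) that] by simp
  qed
  have upd: "\<forall>q<M. \<forall>u<n. ((t ''gain'')(j * (n + 1) + v := gain j v)) (q * (n + 1) + u)
      = (if u < v \<or> u = v \<and> q < Suc j then gain q u else 0)"
    using inv v index_eq_iff by (auto simp: less_Suc_eq simp del: mult_Suc_right)
  \<comment> \<open>Where nothing is stored, the initial 0 is the right value.\<close>
  have same: "\<forall>q<M. \<forall>u<n. t ''gain'' (q * (n + 1) + u)
      = (if u < v \<or> u = v \<and> q < Suc j then gain q u else 0)" if "gain j v = 0"
    using inv that by (auto simp: less_Suc_eq)
  show "runs N ?body t (\<lambda>t. \<forall>q<M. \<forall>u<n.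
    t ''gain'' (q * (n + 1) + u) = (if u < v \<or> u = v \<and> q < Suc j then gain q u else 0))"
  proof (intro runs_intros)
    assume "val (Minus (Var ''p'') (Var ''q'')) t \<noteq> 0"
    then have "gain j v = 2 ^ rank v" using j gain_simps(1)[OF v(2)] by simp
    with upd show "\<forall>q<M. \<forall>u<n. (t(''gain'' := (t ''gain'')(val (Plus (Cell ''mu'' (Var ''q'')) (Var ''v'')) t
        := val (Var ''p'') t))) ''gain'' (q * (n + 1) + u)
      = (if u < v \<or> u = v \<and> q < Suc j then gain q u else 0)"
      using j mu by simp
  next
    assume "val (Minus (Var ''p'') (Var ''q'')) t = 0" "val (Minus (Var ''p2'') (Var ''q'')) t \<noteq> 0"
    then have "gain j v = 0" using j gain_simps(2)[OF v(2)] by simp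
    then show "\<forall>q<M. \<forall>u<n. t ''gain'' (q * (n + 1) + u)
      = (if u < v \<or> u = v \<and> q < Suc j then gain q u else 0)" by (rule same)
  next
    assume "val (Minus (Var ''p2'') (Var ''q'')) t = 0"
    then have "t ''gain'' ((j - 2 * 2 ^ rank v) * (n + 1) + v) = gain j v" using j gain by simp
    with upd show "\<forall>q<M. \<forall>u<n. (t(''gain'' := (t ''gain'')(val (Plus (Cell ''mu'' (Var ''q'')) (Var ''v'')) t
        := val (Cell ''gain'' (Plus (Cell ''mu'' (Minus (Var ''q'') (Var ''p2''))) (Var ''v''))) t))) ''gain''
          (q * (n + 1) + u)
      = (if u < v \<or> u = v \<and> q < Suc j then gain q u else 0)"
      using j mu by simp
  qed
qed (use s pre M_le_N in auto)

lemma runs_gain: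
  assumes "input_ok s" "sizes_ok s" "tables_upto N s" "s ''gain'' = (\<lambda>_. 0)"
  shows "runs N prog_gain s gain_ok"
  unfolding prog_gain_def block.simps
proof (intro runs_Seq runs_Store, rule runs_For[where K = n and Inv = "\<lambda>v t. t ''p'' 0 = 2 ^ rank v \<and>
    (\<forall>q<M. \<forall>u<n. t ''gain'' (q * (n + 1) + u) = (if u < v then gain q u else 0))"])
  let ?P = "Seq (Assign ''p2'' (Plus (Var ''p'') (Var ''p''))) (Seq prog_gain_row (Assign ''p'' (Var ''p2'')))"
  let ?body = "If (Cell ''C'' (Var ''v'')) ?P Skip"
  fix v t
  assume v: "v < n" "t ''v'' 0 = v" and inv: "t ''p'' 0 = 2 ^ rank v \<and>
    (\<forall>q<M. \<forall>u<n. t ''gain'' (q * (n + 1) + u) = (if u < v then gain q u else 0))"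
    and fr: "\<And>y. y \<notin> insert ''v'' (mods ?body) \<Longrightarrow>
      t y = (s(''p'' := (s ''p'')(val (Const 0) s := val (Const 1) s))) y"
  have C: "t ''C'' v = of_bool (v \<in> clients I)"
    using fr[of "''C''"] assms(1) unfolding input_ok_def by simp
  have M: "t ''M'' 0 = M"
    using fr[of "''M''"] assms(2) unfolding sizes_ok_def by simp
  have T: "tables_upto N t"
    using fr[of "''mu''"] fr[of "''mn''"] fr[of "''md''"] fr[of "''dv''"] assms(3)
    unfolding tables_upto_def by simp
  have gain: "runs N prog_gain_row (t(''p2'' := (t ''p2'')(0 := 2 * 2 ^ rank v)))
      (\<lambda>t. \<forall>q<M. \<forall>u<n. t ''gain'' (q * (n + 1) + u) = (if u < Suc v then gain q u else 0))"
    if "v \<in> clients I"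
    using v inv that M T by (intro runs_gain_row) (auto simp: tables_upto_def)
  show "runs N ?body t (\<lambda>t. t ''p'' 0 = 2 ^ rank (Suc v) \<and>
    (\<forall>q<M. \<forall>u<n. t ''gain'' (q * (n + 1) + u) = (if u < Suc v then gain q u else 0)))"
  proof (rule runs_If)
    assume "val (Cell ''C'' (Var ''v'')) t \<noteq> 0"
    then have c: "v \<in> clients I" using C v by simp
    show "runs N ?P t (\<lambda>t. t ''p'' 0 = 2 ^ rank (Suc v) \<and>
    (\<forall>q<M. \<forall>u<n. t ''gain'' (q * (n + 1) + u) = (if u < Suc v then gain q u else 0)))"
      apply (intro runs_Seq runs_Store)
      apply (rule runs_frame)
      apply (rule runs_conseq)
      using gain[OF c] inv apply (simp add: mult_2)
      apply (intro impI runs_Store)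
      using c inv apply (simp add: rank_Suc)
      done
  next
    assume "val (Cell ''C'' (Var ''v'')) t = 0"
    then have "v \<notin> clients I" using C v by (simp split: if_splits)
    with inv show "runs N Skip t (\<lambda>t. t ''p'' 0 = 2 ^ rank (Suc v) \<and>
    (\<forall>q<M. \<forall>u<n. t ''gain'' (q * (n + 1) + u) = (if u < Suc v then gain q u else 0)))"
      by (intro runs_Skip) (auto simp: rank_Suc less_Suc_eq gain_def)
  qed
qed (use assms n_le_N in \<open>auto simp: gain_ok_def input_ok_def rank_def\<close>)

lemma static_simps:
  assumes "static s"
  shows "s ''n'' 0 = n" "s ''k'' 0 = vehicles I" "s ''N'' 0 = N" "s ''M'' 0 = M"
    "x \<le> N \<Longrightarrow> s ''mu'' x = x * (n + 1)" "x \<le> N \<Longrightarrow> s ''mn'' x = x * n"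
    "x \<le> N \<Longrightarrow> s ''md'' x = x mod (n + 1)" "x \<le> N \<Longrightarrow> s ''dv'' x = x div (n + 1)"
  using assms by (auto simp: static_def input_ok_def sizes_ok_def tables_upto_def)

lemma val_components:
  assumes "static s" "s ''i'' 0 = i" "i < N"
  shows "val pos_exp s = pos i" "val home_exp s = home i" "val spare_exp s = spare i"
    "val visited_exp s = visited i"
proof -
  have "i div a \<le> N" "i div a div b \<le> N" for a b
    using assms(3) by (meson div_le_dividend le_trans less_imp_le)+
  then show "val pos_exp s = pos i" "val home_exp s = home i" "val spare_exp s = spare i"
    "val visited_exp s = visited i"
    using assms by (simp_all add: static_simps components)
qed

text \<open>Arguments of \<open>mu\<close> must lie inside the table; the digit prefixes that get
  multiplied stay below \<open>M * (n + 1) * (n + 1) \<le> N\<close>.\<close>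

lemma val_state:
  assumes "static s" "val q s < M" "val j s \<le> n" "val d s \<le> n"
  shows "val (state_exp q j d v) s = state (val q s) (val j s) (val d s) (val v s)"
proof -
  have 1: "val q s * (n + 1) + val j s < M * (n + 1)" using assms by (intro mult_add_less) auto
  then have 2: "(val q s * (n + 1) + val j s) * (n + 1) + val d s < M * (n + 1) * (n + 1)"
    using assms by (intro mult_add_less) auto
  have "M * (n + 1) * 1 * 1 \<le> N" "M * (n + 1) * (n + 1) * 1 \<le> N"
    unfolding N_def by (intro mult_le_mono; simp)+
  then have "val q s * (n + 1) + val j s \<le> N"
    "(val q s * (n + 1) + val j s) * (n + 1) + val d s \<le> N" "val q s \<le> N"
    using 1 2 assms(2) M_le_N by (simp_all del: mult_Suc mult_Suc_right)
  then show ?thesis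
    unfolding state_exp_def state_def
    using static_simps(5)[OF assms(1)] by simp
qed

lemma runs_base:
  assumes "static s" "s ''F'' = (\<lambda>_. 0)"
  shows "runs N prog_base s (\<lambda>t. \<forall>i<N. t ''F'' i = of_bool (goal i))"
  unfolding prog_base_def
proof (rule runs_For[where K = N and Inv = "\<lambda>j t. \<forall>i<N. t ''F'' i = of_bool (i < j \<and> goal i)"])
  let ?body = "If (differ pos_exp home_exp) Skip
      (If (differ visited_exp (Minus (Var ''M'') (Const 1))) Skip
        (Store ''F'' (Var ''i'') (Const 1)))"
  fix j t
  assume j: "j < N" "t ''i'' 0 = j" and inv: "\<forall>i<N. t ''F'' i = of_bool (i < j \<and> goal i)"
    and fr: "\<And>y. y \<notin> insert ''i'' (mods ?body) \<Longrightarrow> t y = s y"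
  have st: "static t" using assms(1) by (rule static_cong, intro fr) auto
  have vals: "val (Minus (Var ''M'') (Const 1)) t = M - 1" "val (Var ''i'') t = j"
    using static_simps(4)[OF st] j by simp_all
  show "runs N ?body t (\<lambda>t. \<forall>i<N. t ''F'' i = of_bool (i < Suc j \<and> goal i))"
  proof (intro runs_If runs_Skip runs_Store)
    assume "val (differ pos_exp home_exp) t \<noteq> 0"
    then have "\<not> goal j"
      unfolding val_differ val_components[OF st j(2) j(1)] goal_def by blast
    then show "\<forall>i<N. t ''F'' i = of_bool (i < Suc j \<and> goal i)"
      using inv by (metis less_Suc_eq)
  next
    assume "val (differ visited_exp (Minus (Var ''M'') (Const 1))) t \<noteq> 0"
    then have "\<not> goal j"
      unfolding val_differ val_components[OF st j(2) j(1)] vals goal_def by blast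
    then show "\<forall>i<N. t ''F'' i = of_bool (i < Suc j \<and> goal i)"
      using inv by (metis less_Suc_eq)
  next
    assume "val (differ pos_exp home_exp) t = 0"
      "val (differ visited_exp (Minus (Var ''M'') (Const 1))) t = 0"
    then have "goal j"
      unfolding val_differ val_components[OF st j(2) j(1)] vals goal_def by blast
    then show "\<forall>i<N. (t(''F'' := (t ''F'')(val (Var ''i'') t := val (Const 1) t))) ''F'' i
        = of_bool (i < Suc j \<and> goal i)"
      using inv unfolding vals by (simp add: less_Suc_eq)
  qed
next
  show "s ''N'' 0 = N" using static_simps(3)[OF assms(1)] .
  show "\<forall>i<N. s ''F'' i = of_bool (i < 0 \<and> goal i)" using assms(2) by simp
next
  fix t assume "\<forall>i<N. t ''F'' i = of_bool (i < N \<and> goal i)"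
  then show "\<forall>i<N. t ''F'' i = of_bool (goal i)" by simp
qed simp_all

definition cell_ok :: "(nat \<Rightarrow> nat) \<Rightarrow> (nat \<times> nat \<times> nat) set \<Rightarrow> nat \<Rightarrow> memory \<Rightarrow> bool" where
  "cell_ok G Ch x s \<longleftrightarrow> best G Ch (s ''F'' x) (s ''ac'' x) (s ''nx'' x)"

definition same_cells :: "nat set \<Rightarrow> memory \<Rightarrow> memory \<Rightarrow> bool" where
  "same_cells Y s t \<longleftrightarrow> (\<forall>y\<in>Y. t ''F'' y = s ''F'' y \<and> t ''ac'' y = s ''ac'' y \<and> t ''nx'' y = s ''nx'' y)"

text \<open>Taking the offer is \<open>best_improve\<close>; declining it, because it is no cheaper
  or leads nowhere, is \<open>best_keep\<close>.\<close>

lemma runs_relax: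
  assumes "cell_ok G Ch x s" "s ''x'' 0 = x"
    and "s ''F'' (s ''base'' 0 + t') = G t'" "s ''t'' 0 = t'" "s ''c'' 0 = c'" "s ''a'' 0 = a'"
  shows "runs X prog_relax s (\<lambda>s'. cell_ok G (insert (a', t', c') Ch) x s' \<and> same_cells (- {x}) s s')"
  unfolding prog_relax_def
proof (intro runs_If)
  assume "val (Cell ''F'' (Plus (Var ''base'') (Var ''t''))) s \<noteq> 0"
      "val (Plus (Minus (Const 1) (Cell ''F'' (Var ''x''))) (Minus (Cell ''F'' (Var ''x''))
         (Plus (Cell ''F'' (Plus (Var ''base'') (Var ''t''))) (Var ''c'')))) s \<noteq> 0"
  then have "G t' \<noteq> 0" "s ''F'' x = 0 \<or> G t' + c' < s ''F'' x"
    using assms by auto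
  from best_improve[OF assms(1)[unfolded cell_ok_def] this, of a']
  show "runs X (block
         [Store ''F'' (Var ''x'') (Plus (Cell ''F'' (Plus (Var ''base'') (Var ''t''))) (Var ''c'')),
          Store ''ac'' (Var ''x'') (Var ''a''),
          Store ''nx'' (Var ''x'') (Var ''t'')]) s
        (\<lambda>s'. cell_ok G (insert (a', t', c') Ch) x s' \<and> same_cells (- {x}) s s')"
    unfolding block.simps
    by (intro runs_Seq runs_Store) (use assms in \<open>simp add: cell_ok_def same_cells_def\<close>)
next
  assume "val (Plus (Minus (Const 1) (Cell ''F'' (Var ''x''))) (Minus (Cell ''F'' (Var ''x''))
         (Plus (Cell ''F'' (Plus (Var ''base'') (Var ''t''))) (Var ''c'')))) s = 0"
  then have "s ''F'' x \<noteq> 0 \<and> s ''F'' x \<le> G t' + c'"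
    using assms by auto
  with best_keep[OF assms(1)[unfolded cell_ok_def]]
  show "runs X Skip s (\<lambda>s'. cell_ok G (insert (a', t', c') Ch) x s' \<and> same_cells (- {x}) s s')"
    by (intro runs_Skip) (simp add: cell_ok_def same_cells_def)
next
  assume "val (Cell ''F'' (Plus (Var ''base'') (Var ''t''))) s = 0"
  then have "G t' = 0" using assms by simp
  with best_keep[OF assms(1)[unfolded cell_ok_def]]
  show "runs X Skip s (\<lambda>s'. cell_ok G (insert (a', t', c') Ch) x s' \<and> same_cells (- {x}) s s')"
    by (intro runs_Skip) (simp add: cell_ok_def same_cells_def)
qed

lemma runs_offer:
  assumes "cell_ok G Ch x s" "s ''x'' 0 = x" "val e s = t'" "s ''F'' (s ''base'' 0 + t') = G t'"
    and "val f (s(''t'' := (s ''t'')(0 := t'))) = c'"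
  shows "runs X (block [Assign ''t'' e, Assign ''c'' f, Assign ''a'' (Const a'), prog_relax]) s
    (\<lambda>s'. cell_ok G (insert (a', t', c') Ch) x s' \<and> same_cells (- {x}) s s')"
  unfolding block.simps
  apply (intro runs_Seq runs_Store)
  apply (rule runs_conseq, rule runs_relax[where G = G and Ch = Ch and x = x])
  using assms by (auto simp: cell_ok_def same_cells_def)

text \<open>By \<open>s ''base'' 0 + N \<le> x\<close> the cell being written lies outside the layer
  being read, so \<open>G\<close> still describes that layer when the second offer is
  evaluated.\<close>

lemma runs_choice:
  assumes s: "static s" "s ''i'' 0 = i" "i < N" "s ''u'' 0 = u" "u < n" "s ''x'' 0 = x"
    and G: "\<And>t. t < N \<Longrightarrow> s ''F'' (s ''base'' 0 + t) = G t"
    and x: "s ''base'' 0 + N \<le> x"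
    and ok: "cell_ok G (choices i u) x s"
  shows "runs X prog_choice s (\<lambda>t. cell_ok G (choices i (Suc u)) x t \<and> same_cells (- {x}) s t)"
proof -
  \<comment> \<open>The choices after the edge test and before the depot test, as in
    \<open>choices_Suc\<close>.\<close>
  define Ch where "Ch = (if {pos i, u} \<in> edges I then insert (1, move i u, weight I {pos i, u}) else id)
    (choices i u)"
  define s1 where "s1 = s(''q'' := (s ''q'')(0 := visit (visited i) u))"
  have st1: "static s1"
    using s(1) by (rule static_cong) (auto simp: s1_def)
  note vals1 = val_components[OF st1, of i]
  have i1: "s1 ''i'' 0 = i" "s1 ''u'' 0 = u" using s by (auto simp: s1_def)
  have q: "val (Plus visited_exp (Cell ''gain'' (Plus (Cell ''mu'' visited_exp) (Var ''u'')))) s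
      = visit (visited i) u"
  proof -
    have "visited i < M" using visited_less s(3) .
    then have "s ''mu'' (visited i) = visited i * (n + 1)"
      using static_simps(5)[OF s(1)] M_le_N by auto
    moreover have "s ''gain'' (visited i * (n + 1) + u) = gain (visited i) u"
      using s(1,5) \<open>visited i < M\<close> unfolding static_def gain_ok_def by blast
    ultimately show ?thesis
      using val_components(4)[OF s(1-3)] s(4) by (simp add: visit_def)
  qed
  have vis: "visit (visited i) u < M" using visit_less visited_less s(3) by blast
  have adj: "s ''adj'' (pos i * n + u) = of_bool ({pos i, u} \<in> edges I)"
    "{pos i, u} \<in> edges I \<Longrightarrow> s ''w'' (pos i * n + u) = weight I {pos i, u}"
    using s(1,5) unfolding static_def input_ok_def by auto
  have mn: "t ''mn'' (pos i) = pos i * n" if "static t" for t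
    using static_simps(6)[OF that, of "pos i"] n_le_N components_le(1)[of i] by linarith
  have "runs X (If (Cell ''adj'' (Plus (Cell ''mn'' pos_exp) (Var ''u'')))
      (block
        [Assign ''t'' (state_exp (Var ''q'') spare_exp home_exp (Var ''u'')),
         Assign ''c'' (Cell ''w'' (Plus (Cell ''mn'' pos_exp) (Var ''u''))),
         Assign ''a'' (Const 1),
         prog_relax])
      Skip) s1 (\<lambda>t. cell_ok G Ch x t \<and> same_cells (- {x}) s1 t)"
  proof (rule runs_If)
    assume "val (Cell ''adj'' (Plus (Cell ''mn'' pos_exp) (Var ''u''))) s1 \<noteq> 0"
    then have "s ''adj'' (pos i * n + u) \<noteq> 0"
      using vals1(1)[OF i1(1) s(3)] mn[OF st1] i1 by (simp add: s1_def)
    then have e: "{pos i, u} \<in> edges I" using adj by (simp split: if_splits)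
    have t: "val (state_exp (Var ''q'') spare_exp home_exp (Var ''u'')) s1 = move i u"
      using vis vals1[OF i1(1) s(3)] i1
      by (subst val_state[OF st1]) (simp_all add: s1_def move_def)
    have "move i u < N"
      unfolding move_def using s vis by (intro state_less) auto
    moreover have "static (s1(''t'' := (s1 ''t'')(0 := move i u)))"
      using st1 by (rule static_cong) auto
    note mn[OF this] val_components(1)[OF this, of i]
    ultimately show "runs X (block
        [Assign ''t'' (state_exp (Var ''q'') spare_exp home_exp (Var ''u'')),
         Assign ''c'' (Cell ''w'' (Plus (Cell ''mn'' pos_exp) (Var ''u''))),
         Assign ''a'' (Const 1),
         prog_relax]) s1 (\<lambda>t. cell_ok G Ch x t \<and> same_cells (- {x}) s1 t)"
      unfolding Ch_def if_P[OF e]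
      using ok G s adj(2)[OF e] i1 by (intro runs_offer t) (auto simp: s1_def cell_ok_def)
  next
    assume "val (Cell ''adj'' (Plus (Cell ''mn'' pos_exp) (Var ''u''))) s1 = 0"
    then have "s ''adj'' (pos i * n + u) = 0"
      using vals1(1)[OF i1(1) s(3)] mn[OF st1] i1 by (simp add: s1_def)
    then have "{pos i, u} \<notin> edges I" using adj by (simp split: if_splits)
    then show "runs X Skip s1 (\<lambda>t. cell_ok G Ch x t \<and> same_cells (- {x}) s1 t)"
      using ok by (intro runs_Skip) (auto simp: Ch_def s1_def cell_ok_def same_cells_def)
  qed
  moreover have "runs X (If (Cell ''D'' (Var ''u''))
      (If spare_exp
        (If (differ pos_exp home_exp) Skip
          (block
            [Assign ''t'' (state_exp (Var ''q'') (Minus spare_exp (Const 1)) (Var ''u'') (Var ''u'')),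
             Assign ''c'' (Const 0),
             Assign ''a'' (Const 2),
             prog_relax]))
        Skip)
      Skip) s2 (\<lambda>t. cell_ok G (choices i (Suc u)) x t \<and> same_cells (- {x}) s t)"
    if s2: "cell_ok G Ch x s2" "same_cells (- {x}) s1 s2"
      "\<And>y. y \<notin> {''t'', ''c'', ''a'', ''F'', ''ac'', ''nx''} \<Longrightarrow> s2 y = s1 y" for s2
  proof -
    have st2: "static s2" using st1 by (rule static_cong, intro s2(3)) auto
    have i2: "s2 ''i'' 0 = i" "s2 ''u'' 0 = u" "s2 ''x'' 0 = x" "s2 ''q'' 0 = visit (visited i) u"
      "s2 ''base'' 0 = s ''base'' 0"
      using s2(3) i1 s by (auto simp: s1_def)
    note vals2 = val_components[OF st2 i2(1) s(3)]
    have same: "same_cells (- {x}) s s2"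
      using s2(2) by (simp add: same_cells_def s1_def)
    have D: "s2 ''D'' u = of_bool (u \<in> depots I)"
      using st2 unfolding static_def input_ok_def by blast
    have skip: "runs X Skip s2 (\<lambda>t. cell_ok G (choices i (Suc u)) x t \<and> same_cells (- {x}) s t)"
      if "\<not> can_depart i u"
      using that s2(1) same unfolding choices_Suc Ch_def by (intro runs_Skip) simp
    show ?thesis
    proof (intro runs_If)
      assume "val (Cell ''D'' (Var ''u'')) s2 \<noteq> 0" "val spare_exp s2 \<noteq> 0"
        "val (differ pos_exp home_exp) s2 = 0"
      then have c: "can_depart i u"
        unfolding val_differ vals2 using D i2 by (auto simp: can_depart_def split: if_splits)
      have "spare i - 1 \<le> n" using components_le(3)[of i] by linarith
      then have t: "val (state_exp (Var ''q'') (Minus spare_exp (Const 1)) (Var ''u'') (Var ''u'')) s2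
          = depart i u"
        using vis vals2 i2 s(5) unfolding depart_def
        by (subst val_state[OF st2]) simp_all
      have "depart i u < N"
        using vis s(5) \<open>spare i - 1 \<le> n\<close> unfolding depart_def by (intro state_less) auto
      then have F: "s2 ''F'' (s2 ''base'' 0 + depart i u) = G (depart i u)"
        using G[of "depart i u"] same x i2 unfolding same_cells_def by auto
      have Ch: "choices i (Suc u) = insert (2, depart i u, 0) Ch"
        unfolding choices_Suc Ch_def using c by simp
      have "runs X (block
            [Assign ''t'' (state_exp (Var ''q'') (Minus spare_exp (Const 1)) (Var ''u'') (Var ''u'')),
             Assign ''c'' (Const 0),
             Assign ''a'' (Const 2),
             prog_relax]) s2 (\<lambda>t. cell_ok G (choices i (Suc u)) x t \<and> same_cells (- {x}) s2 t)"
        unfolding Ch by (intro runs_offer s2(1) i2(3) t F) simp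
      then show "runs X (block
            [Assign ''t'' (state_exp (Var ''q'') (Minus spare_exp (Const 1)) (Var ''u'') (Var ''u'')),
             Assign ''c'' (Const 0),
             Assign ''a'' (Const 2),
             prog_relax]) s2 (\<lambda>t. cell_ok G (choices i (Suc u)) x t \<and> same_cells (- {x}) s t)"
        by (rule runs_conseq) (use same in \<open>simp add: same_cells_def\<close>)
    next
      assume "val (differ pos_exp home_exp) s2 \<noteq> 0"
      then show "runs X Skip s2 (\<lambda>t. cell_ok G (choices i (Suc u)) x t \<and> same_cells (- {x}) s t)"
        unfolding val_differ vals2 by (intro skip) (simp add: can_depart_def)
    next
      assume "val spare_exp s2 = 0"
      then show "runs X Skip s2 (\<lambda>t. cell_ok G (choices i (Suc u)) x t \<and> same_cells (- {x}) s t)"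
        unfolding vals2 by (intro skip) (simp add: can_depart_def)
    next
      assume "val (Cell ''D'' (Var ''u'')) s2 = 0"
      then have "u \<notin> depots I" using D i2 by (simp split: if_splits)
      then show "runs X Skip s2 (\<lambda>t. cell_ok G (choices i (Suc u)) x t \<and> same_cells (- {x}) s t)"
        by (intro skip) (simp add: can_depart_def)
    qed
  qed
  ultimately show ?thesis
    unfolding prog_choice_def block.simps
    apply (intro runs_Seq runs_Store)
    unfolding q
    apply (rule runs_frame)
    apply (rule runs_conseq)
    unfolding s1_def[symmetric] val.simps
     apply assumption
    apply (intro impI)
    apply simp
    done
qed

lemma runs_state:
  assumes s: "static s" "s ''i'' 0 = i" "i < N" "s ''base'' 0 = b" "s ''cur'' 0 = b + N"
  shows "runs N prog_state s
    (\<lambda>t. cell_ok (\<lambda>u. s ''F'' (b + u)) (choices i n) (b + N + i) t \<and> same_cells (- {b + N + i}) s t)"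
proof -
  define x where "x = b + N + i"
  define G where "G = (\<lambda>u. s ''F'' (b + u))"
  define s1 where "s1 = s(''x'' := (s ''x'')(0 := x), ''F'' := (s ''F'')(x := G i),
    ''ac'' := (s ''ac'')(x := 0), ''nx'' := (s ''nx'')(x := i))"
  have st1: "static s1"
    using s(1) by (rule static_cong) (auto simp: s1_def)
  have same: "same_cells (- {x}) s s1"
    by (simp add: same_cells_def s1_def)
  have s1: "s1 ''base'' 0 = b" "s1 ''x'' 0 = x" "s1 ''i'' 0 = i"
    using s by (simp_all add: s1_def)
  have "runs N (For ''u'' ''n'' prog_choice) s1
    (\<lambda>t. cell_ok G (choices i n) x t \<and> same_cells (- {x}) s t)"
  proof (rule runs_For[where K = n and
        Inv = "\<lambda>u t. cell_ok G (choices i u) x t \<and> same_cells (- {x}) s1 t"])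
    fix u t
    assume u: "u < n" "t ''u'' 0 = u" "cell_ok G (choices i u) x t \<and> same_cells (- {x}) s1 t"
      and fr: "\<And>y. y \<notin> insert ''u'' (mods prog_choice) \<Longrightarrow> t y = s1 y"
    have st: "static t"
      using st1 by (rule static_cong, intro fr) auto
    have t: "t ''base'' 0 = b" "t ''x'' 0 = x" "t ''i'' 0 = i"
      using s1 by (simp_all add: fr)
    have "t ''F'' (t ''base'' 0 + v) = G v" if "v < N" for v
      using u(3) that unfolding t same_cells_def s1_def x_def G_def by simp
    then have "runs N prog_choice t (\<lambda>t'. cell_ok G (choices i (Suc u)) x t' \<and> same_cells (- {x}) t t')"
      using u s st t by (intro runs_choice) (auto simp: x_def)
    then show "runs N prog_choice t (\<lambda>t'. cell_ok G (choices i (Suc u)) x t' \<and> same_cells (- {x}) s1 t')"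
      by (rule runs_conseq) (use u(3) in \<open>simp add: same_cells_def\<close>)
  next
    show "s1 ''n'' 0 = n" using static_simps(1)[OF st1] .
    show "n \<le> N" using n_le_N by simp
    show "cell_ok G (choices i 0) x s1 \<and> same_cells (- {x}) s1 s1"
      using best_stay by (simp add: cell_ok_def same_cells_def s1_def)
  next
    fix t
    assume "cell_ok G (choices i n) x t \<and> same_cells (- {x}) s1 t"
    then show "cell_ok G (choices i n) x t \<and> same_cells (- {x}) s t"
      using same by (simp add: same_cells_def)
  qed (simp_all add: cell_ok_def same_cells_def)
  then show ?thesis
    unfolding prog_state_def block.simps
    by (intro runs_Seq runs_Store) (use s in \<open>simp add: s1_def G_def x_def\<close>)
qed

lemma runs_layer:
  assumes s: "static s" "s ''base'' 0 = L * N" and tab: "table (s ''F'') (s ''ac'') (s ''nx'') L"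
  shows "runs N prog_layer s
    (\<lambda>t. t ''base'' 0 = Suc L * N \<and> table (t ''F'') (t ''ac'') (t ''nx'') (Suc L))"
proof -
  define b where "b = L * N"
  define G where "G = (\<lambda>u. s ''F'' (b + u))"
  define s1 where "s1 = s(''cur'' := (s ''cur'')(0 := b + N))"
  have st1: "static s1"
    using s(1) by (rule static_cong) (auto simp: s1_def)
  have s1: "s1 ''base'' 0 = b" "s1 ''cur'' 0 = b + N" "s1 ''F'' = s ''F''" "s1 ''ac'' = s ''ac''"
    "s1 ''nx'' = s ''nx''"
    using s by (simp_all add: s1_def b_def)
  have "runs N (For ''i'' ''N'' prog_state) s1
    (\<lambda>t. t ''cur'' 0 = b + N \<and> table (t ''F'') (t ''ac'') (t ''nx'') (Suc L))"
  proof (rule runs_For[where K = N and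
        Inv = "\<lambda>j t. (\<forall>i<j. cell_ok G (choices i n) (b + N + i) t) \<and> same_cells {..<b + N} s t"])
    fix j t
    assume j: "j < N" "t ''i'' 0 = j"
      and inv: "(\<forall>i<j. cell_ok G (choices i n) (b + N + i) t) \<and> same_cells {..<b + N} s t"
      and fr: "\<And>y. y \<notin> insert ''i'' (mods prog_state) \<Longrightarrow> t y = s1 y"
    have st: "static t"
      using st1 by (rule static_cong, intro fr) auto
    have t: "t ''base'' 0 = b" "t ''cur'' 0 = b + N"
      using s1 by (simp_all add: fr)
    have G: "t ''F'' (b + u) = G u" if "u < N" for u
      using inv that by (simp add: same_cells_def G_def)
    show "runs N prog_state t (\<lambda>t. (\<forall>i<Suc j. cell_ok G (choices i n) (b + N + i) t) \<and>
        same_cells {..<b + N} s t)"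
    proof (rule runs_conseq[OF runs_state[OF st j(2,1) t]])
      fix t'
      assume t': "cell_ok (\<lambda>u. t ''F'' (b + u)) (choices j n) (b + N + j) t' \<and>
        same_cells (- {b + N + j}) t t'"
      \<comment> \<open>The layer read from \<open>t\<close> is exchanged for that of
        \<open>s\<close>: all next states are below \<open>N\<close>, where the two agree.\<close>
      then have "cell_ok G (choices j n) (b + N + j) t'"
        unfolding cell_ok_def using best_cong G choices_less[OF _ j(1)] by blast
      moreover have "cell_ok G (choices i n) (b + N + i) t'" if "i < j" for i
        using inv t' that by (simp add: cell_ok_def same_cells_def)
      ultimately show "(\<forall>i<Suc j. cell_ok G (choices i n) (b + N + i) t') \<and> same_cells {..<b + N} s t'"
        using inv t' by (auto simp: less_Suc_eq same_cells_def)
    qed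
  next
    show "s1 ''N'' 0 = N" using static_simps(3)[OF st1] .
    show "(\<forall>i<0. cell_ok G (choices i n) (b + N + i) s1) \<and> same_cells {..<b + N} s s1"
      using s1 by (simp add: same_cells_def)
  next
    fix t
    assume fr: "\<And>y. y \<notin> insert ''i'' (mods prog_state) \<Longrightarrow> t y = s1 y"
      and inv: "(\<forall>i<N. cell_ok G (choices i n) (b + N + i) t) \<and> same_cells {..<b + N} s t"
    have "table (t ''F'') (t ''ac'') (t ''nx'') (Suc L)"
      using tab
    proof (rule table_extend)
      fix y assume "y < Suc L * N"
      then show "t ''F'' y = s ''F'' y \<and> t ''ac'' y = s ''ac'' y \<and> t ''nx'' y = s ''nx'' y"
        using inv by (simp add: same_cells_def b_def)
    next
      fix i assume "i < N"
      then show "best (\<lambda>t. s ''F'' (L * N + t)) (choices i n) (t ''F'' (Suc L * N + i))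
        (t ''ac'' (Suc L * N + i)) (t ''nx'' (Suc L * N + i))"
        using inv by (simp add: cell_ok_def b_def G_def add.commute[of N])
    qed
    then show "t ''cur'' 0 = b + N \<and> table (t ''F'') (t ''ac'') (t ''nx'') (Suc L)"
      using s1(2) by (simp add: fr)
  qed (simp_all add: cell_ok_def same_cells_def)
  then have loop: "runs N (For ''i'' ''N'' prog_state) s1 (\<lambda>t. runs N (Assign ''base'' (Var ''cur'')) t
      (\<lambda>t. t ''base'' 0 = Suc L * N \<and> table (t ''F'') (t ''ac'') (t ''nx'') (Suc L)))"
    by (rule runs_conseq) (intro runs_Store, simp add: b_def)
  have N: "s ''N'' 0 = N" using static_simps(3)[OF s(1)] .
  show ?thesis
    unfolding prog_layer_def block.simps
    by (intro runs_Seq runs_Store) (use loop s N in \<open>simp add: s1_def b_def\<close>)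
qed

lemma runs_layers:
  assumes s: "static s" "\<forall>i<N. s ''F'' i = of_bool (goal i)"
  shows "runs N prog_layers s
    (\<lambda>t. t ''base'' 0 = N * N \<and> table (t ''F'') (t ''ac'') (t ''nx'') N)"
  unfolding prog_layers_def block.simps
proof (intro runs_Seq runs_Store, rule runs_For[where K = N and
      Inv = "\<lambda>L t. t ''base'' 0 = L * N \<and> table (t ''F'') (t ''ac'') (t ''nx'') L"])
  let ?s = "s(''base'' := (s ''base'')(val (Const 0) s := val (Const 0) s))"
  show "?s ''N'' 0 = N" using static_simps(3)[OF s(1)] by simp
  show "?s ''base'' 0 = 0 * N \<and> table (?s ''F'') (?s ''ac'') (?s ''nx'') 0"
    using s(2) by (simp add: table_def)
  fix L t
  assume inv: "t ''base'' 0 = L * N \<and> table (t ''F'') (t ''ac'') (t ''nx'') L"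
    and fr: "\<And>y. y \<notin> insert ''l'' (mods prog_layer) \<Longrightarrow> t y = ?s y"
  have fr': "t y = s y" if "y \<notin> {''base''} \<union> insert ''l'' (mods prog_layer)" for y
    using fr[of y] that by simp
  have "static t"
    using s(1) by (rule static_cong, intro fr') auto
  with inv show "runs N prog_layer t
      (\<lambda>t. t ''base'' 0 = Suc L * N \<and> table (t ''F'') (t ''ac'') (t ''nx'') (Suc L))"
    by (intro runs_layer) auto
qed simp_all

end

section \<open>Emitting the walks\<close>

text \<open>Bounding every entry of \<open>start\<close> by \<open>len\<close> ensures that writing
  at position \<open>len\<close> leaves the existing segments intact.\<close>

definition rep :: "memory \<Rightarrow> nat list list \<Rightarrow> bool" where
  "rep s Ws \<longleftrightarrow> s ''count'' 0 = length Ws \<and> s ''start'' (length Ws) = s ''len'' 0 \<and>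
     (\<forall>i\<le>length Ws. s ''start'' i \<le> s ''len'' 0) \<and> output_walks s = Ws"

text \<open>Only the end mark of the last segment moves, by one cell.\<close>

lemma rep_extend_last:
  assumes "rep s Ws" "Ws \<noteq> []"
    and t: "t ''count'' 0 = s ''count'' 0" "t ''len'' 0 = Suc (s ''len'' 0)"
      "t ''walk'' = (s ''walk'')(s ''len'' 0 := u)"
      "t ''start'' = (s ''start'')(s ''count'' 0 := Suc (s ''len'' 0))"
  shows "rep t (butlast Ws @ [last Ws @ [u]])"
proof -
  obtain m where m: "length Ws = Suc m" using assms(2) by (cases Ws) auto
  let ?seg = "\<lambda>s i. map (s ''walk'') [s ''start'' i ..< s ''start'' (Suc i)]"
  have c: "s ''count'' 0 = Suc m" "s ''start'' (Suc m) = s ''len'' 0"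
    "\<And>i. i \<le> Suc m \<Longrightarrow> s ''start'' i \<le> s ''len'' 0" "output_walks s = Ws"
    using assms(1) m by (auto simp: rep_def)
  have Ws: "Ws = map (?seg s) [0..<m] @ [?seg s m]"
    using c(1,4) by (simp add: output_walks_def)
  have "?seg t i = ?seg s i" if "i < m" for i
    using that c(1) c(3)[of "Suc i"] by (simp add: t)
  moreover have "?seg t m = ?seg s m @ [u]"
    using c(3)[of m] by (simp add: t c)
  ultimately have "output_walks t = map (?seg s) [0..<m] @ [?seg s m @ [u]]"
    unfolding output_walks_def t(1) c(1) by simp
  also have "\<dots> = butlast Ws @ [last Ws @ [u]]"
    by (subst (1 2) Ws) simp
  finally show ?thesis
    using c m unfolding rep_def by (auto simp: t le_Suc_eq intro: le_SucI)
qed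

text \<open>The end of the old last segment is already \<open>len\<close>, so one further end mark
  opens a segment of length one.\<close>

lemma rep_new_walk:
  assumes "rep s Ws"
    and t: "t ''count'' 0 = Suc (s ''count'' 0)" "t ''len'' 0 = Suc (s ''len'' 0)"
      "t ''walk'' = (s ''walk'')(s ''len'' 0 := u)"
      "t ''start'' = (s ''start'')(Suc (s ''count'' 0) := Suc (s ''len'' 0))"
  shows "rep t (Ws @ [[u]])"
proof -
  define m where "m = length Ws"
  let ?seg = "\<lambda>s i. map (s ''walk'') [s ''start'' i ..< s ''start'' (Suc i)]"
  have c: "s ''count'' 0 = m" "s ''start'' m = s ''len'' 0"
    "\<And>i. i \<le> m \<Longrightarrow> s ''start'' i \<le> s ''len'' 0" "output_walks s = Ws"
    using assms(1) m_def by (auto simp: rep_def)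
  have Ws: "map (?seg s) [0..<m] = Ws"
    using c(1,4) by (simp add: output_walks_def)
  have "?seg t i = ?seg s i" if "i < m" for i
    using that c(1) c(3)[of "Suc i"] by (simp add: t)
  then have "map (?seg t) [0..<m] = Ws"
    unfolding Ws[symmetric] by simp
  moreover have "?seg t m = [u]"
    by (simp add: t c)
  ultimately have "output_walks t = Ws @ [[u]]"
    unfolding output_walks_def t(1) c(1) by simp
  then show ?thesis
    using c m_def unfolding rep_def by (auto simp: t le_Suc_eq intro: le_SucI)
qed

section \<open>Correctness of the trace, and the time bound\<close>

context numbered_vrp
begin

text \<open>\<open>m\<close> steps remain. \<open>K\<close> stays fixed: it is the weight emitted so
  far plus the encoded cost still ahead, hence in the end one more than the weight of the
  routing.\<close>

definition trace_ok :: "nat \<Rightarrow> nat \<Rightarrow> memory \<Rightarrow> bool" where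
  "trace_ok m K s \<longleftrightarrow> (\<exists>Ws. s ''base'' 0 = m * N \<and> s ''i'' 0 < N \<and>
     s ''F'' (m * N + s ''i'' 0) \<noteq> 0 \<and> rep s Ws \<and> partial (s ''i'' 0) Ws (s ''assign'') \<and>
     routing_weight I Ws + s ''F'' (m * N + s ''i'' 0) = K)"

text \<open>The recorded choice attains its entry exactly, so the remaining entry loses what the
  emitted walks gain in weight.\<close>

lemma runs_emit:
  assumes st: "static s" and tab: "table (s ''F'') (s ''ac'') (s ''nx'') N" and m: "m < N"
    and ok: "trace_ok (Suc m) K s"
  shows "runs X prog_emit s (trace_ok m K)"
proof -
  define i where "i = s ''i'' 0"
  define x where "x = s ''base'' 0 + i"
  have xs: "s ''base'' 0 + s ''i'' 0 = x" by (simp add: x_def i_def)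
  obtain Ws where x: "x = Suc m * N + i" and base: "s ''base'' 0 = Suc m * N" and i: "i < N"
    and F: "s ''F'' x \<noteq> 0" and rep: "rep s Ws" and part: "partial i Ws (s ''assign'')"
    and K: "routing_weight I Ws + s ''F'' x = K"
    using ok unfolding trace_ok_def x_def i_def by metis
  have count: "s ''count'' 0 = length Ws" using rep by (simp add: rep_def)
  have N: "s ''N'' 0 = N" using static_simps(3)[OF st] .
  have "best (\<lambda>t. s ''F'' (m * N + t)) (choices i n) (s ''F'' x) (s ''ac'' x) (s ''nx'' x)"
    using tab m i unfolding table_def x by blast
  then obtain c where c: "(s ''ac'' x, s ''nx'' x, c) \<in> choices i n"
    "s ''F'' (m * N + s ''nx'' x) \<noteq> 0" "s ''F'' x = s ''F'' (m * N + s ''nx'' x) + c"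
    using F unfolding best_def by auto
  have nx: "s ''nx'' x < N" using choices_less c(1) i by blast
  have md: "s ''md'' (s ''nx'' x) = pos (s ''nx'' x)"
    using static_simps(7)[OF st, of "s ''nx'' x"] nx by (simp add: pos_def)
  have okI: "trace_ok m K t"
    if "t ''base'' 0 = s ''base'' 0 - s ''N'' 0" "t ''i'' 0 = s ''nx'' x" "t ''F'' = s ''F''"
      "rep t Ws'" "partial (s ''nx'' x) Ws' (t ''assign'')"
      "routing_weight I Ws' = routing_weight I Ws + c"
    for t Ws'
  proof -
    have "t ''base'' 0 = m * N" using that(1) base N by simp
    moreover have "routing_weight I Ws' + t ''F'' (m * N + t ''i'' 0) = K"
      using that K c(3) by simp
    ultimately show ?thesis
      unfolding trace_ok_def using that nx c(2) by auto
  qed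
  from c(1) consider
      (stay) "s ''ac'' x = 0" "s ''nx'' x = i" "c = 0"
    | (move) u where "s ''ac'' x = 1" "s ''nx'' x = move i u" "c = weight I {pos i, u}" "u < n"
        "{pos i, u} \<in> edges I"
    | (depart) u where "s ''ac'' x = 2" "s ''nx'' x = depart i u" "c = 0" "u < n" "can_depart i u"
    unfolding choices_def by auto
  then show ?thesis
  proof cases
    case stay
    have fin: "trace_ok m K t"
      if "t ''base'' 0 = s ''base'' 0 - s ''N'' 0" "t ''i'' 0 = s ''nx'' x" "t ''F'' = s ''F''"
        "t ''count'' = s ''count''" "t ''start'' = s ''start''" "t ''len'' = s ''len''"
        "t ''walk'' = s ''walk''" "t ''assign'' = s ''assign''" for t
      using that rep part stay
      by (intro okI[of _ Ws]) (auto simp: rep_def output_walks_def)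
    show ?thesis
      unfolding prog_emit_def block.simps
      by (auto simp: runs_Store_simps xs stay(1) intro!: runs_Skip runs_If runs_Seq fin)
  next
    case move
    define Ws' where "Ws' = butlast Ws @ [last Ws @ [u]]"
    note ext = partial_extend[OF part move(5), folded Ws'_def]
    have pos: "pos (s ''nx'' x) = u" using move by (simp add: move_def)
    have fin: "trace_ok m K t"
      if "t ''base'' 0 = s ''base'' 0 - s ''N'' 0" "t ''i'' 0 = s ''nx'' x" "t ''F'' = s ''F''"
        "t ''count'' = s ''count''" "t ''len'' 0 = Suc (s ''len'' 0)"
        "t ''walk'' = (s ''walk'')(s ''len'' 0 := u)"
        "t ''start'' = (s ''start'')(s ''count'' 0 := Suc (s ''len'' 0))"
        "t ''assign'' = (s ''assign'')(u := s ''count'' 0 - 1)" for t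
      using that ext move(2,3) unfolding Ws'_def
      by (intro okI[of _ "butlast Ws @ [last Ws @ [u]]"] rep_extend_last[OF rep])
        (simp_all add: count)
    show ?thesis
      unfolding prog_emit_def block.simps
      by (auto simp: runs_Store_simps xs move(1) md pos intro!: runs_Skip runs_If runs_Seq fin)
  next
    case depart
    note ext = partial_depart[OF part depart(5)]
    have pos: "pos (s ''nx'' x) = u" using depart components_le(3)[of i]
      by (simp add: depart_def del: components_le)
    have fin: "trace_ok m K t"
      if "t ''base'' 0 = s ''base'' 0 - s ''N'' 0" "t ''i'' 0 = s ''nx'' x" "t ''F'' = s ''F''"
        "t ''count'' 0 = Suc (s ''count'' 0)" "t ''len'' 0 = Suc (s ''len'' 0)"
        "t ''walk'' = (s ''walk'')(s ''len'' 0 := u)"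
        "t ''start'' = (s ''start'')(Suc (s ''count'' 0) := Suc (s ''len'' 0))"
        "t ''assign'' = (s ''assign'')(u := s ''count'' 0)" for t
      using that ext depart(2,3)
      by (intro okI[of _ "Ws @ [[u]]"] rep_new_walk[OF rep]) (simp_all add: count)
    show ?thesis
      unfolding prog_emit_def block.simps
      by (auto simp: runs_Store_simps xs depart(1) md pos intro!: runs_Skip runs_If runs_Seq fin)
  qed
qed

text \<open>A nonzero entry of layer 0 is 1 and marks a goal. So the emitted weight is one less than
  the entry of \<open>initial\<close>, which \<open>table_optimal\<close> bounds by one more than
  the weight of any routing.\<close>

lemma trace_ok_optimal:
  assumes "table F A T N" "t ''F'' = F" "trace_ok 0 (F (N * N + initial)) t"
  shows "optimal_routing I (output_walks t) (output_assignment t)"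
proof -
  obtain Ws where Ws: "t ''i'' 0 < N" "F (t ''i'' 0) \<noteq> 0" "output_walks t = Ws"
    "partial (t ''i'' 0) Ws (t ''assign'')"
    "routing_weight I Ws + F (t ''i'' 0) = F (N * N + initial)"
    using assms(2,3) unfolding trace_ok_def rep_def by auto
  have "F (t ''i'' 0) = of_bool (goal (t ''i'' 0))"
    using assms(1) Ws(1) unfolding table_def by blast
  with Ws have "goal (t ''i'' 0)" "F (N * N + initial) = Suc (routing_weight I Ws)"
    by (auto split: if_splits)
  then show ?thesis
    using partial_goal[OF Ws(4)] table_optimal[OF assms(1)]
    unfolding optimal_routing_def output_assignment_def Ws(3) by auto
qed

lemma runs_trace:
  assumes st: "static s" and tab: "table (s ''F'') (s ''ac'') (s ''nx'') N"
    and z: "s ''base'' 0 = N * N" "s ''count'' 0 = 0" "s ''start'' 0 = 0" "s ''len'' 0 = 0"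
      "s ''feasible'' 0 = 0"
  shows "runs N prog_trace s (correct_output I)"
proof -
  define F where "F = s ''F''"
  define s1 where "s1 = s(''i'' := (s ''i'')(0 := initial))"
  have st1: "static s1"
    using st by (rule static_cong) (auto simp: s1_def)
  have "n - (n - vehicles I) = min (vehicles I) n" by auto
  then have init: "val (state_exp (Const 0) (Minus (Var ''n'') (Minus (Var ''n'') (Var ''k'')))
       (Var ''n'') (Var ''n'')) s = initial"
    using st static_simps(1,2)[OF st] by (subst val_state) (auto simp: initial_def)
  have "runs N (If (Cell ''F'' (Plus (Var ''base'') (Var ''i'')))
      (block [Assign ''feasible'' (Const 1), For ''l'' ''N'' prog_emit])
      Skip) s1 (correct_output I)"
  proof (rule runs_If)
    assume "val (Cell ''F'' (Plus (Var ''base'') (Var ''i''))) s1 \<noteq> 0"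
    then have F0: "F (N * N + initial) \<noteq> 0" using z by (simp add: s1_def F_def)
    define s2 where "s2 = s1(''feasible'' := (s1 ''feasible'')(0 := 1))"
    have st2: "static s2"
      using st1 by (rule static_cong) (auto simp: s2_def)
    have s2F: "s2 ''F'' = s ''F''" "s2 ''ac'' = s ''ac''" "s2 ''nx'' = s ''nx''"
      by (simp_all add: s2_def s1_def)
    have "runs N (For ''l'' ''N'' prog_emit) s2 (correct_output I)"
    \<comment> \<open>The counter goes up while the layer to be read goes down.\<close>
    proof (rule runs_For[where K = N and Inv = "\<lambda>l t. trace_ok (N - l) (F (N * N + initial)) t"])
      fix l t
      assume l: "l < N" and inv: "trace_ok (N - l) (F (N * N + initial)) t"
        and fr: "\<And>y. y \<notin> insert ''l'' (mods prog_emit) \<Longrightarrow> t y = s2 y"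
      have "static t"
        using st2 by (rule static_cong, intro fr) auto
      moreover have "table (t ''F'') (t ''ac'') (t ''nx'') N"
        using tab s2F by (simp add: fr)
      moreover have "trace_ok (Suc (N - Suc l)) (F (N * N + initial)) t"
        using inv l by (simp add: Suc_diff_Suc)
      ultimately show "runs N prog_emit t (trace_ok (N - Suc l) (F (N * N + initial)))"
        using l by (intro runs_emit) auto
    next
      show "s2 ''N'' 0 = N" using static_simps(3)[OF st2] .
      have "rep s2 []"
        using z by (simp add: rep_def output_walks_def s2_def s1_def)
      then show "trace_ok (N - 0) (F (N * N + initial)) s2"
        unfolding trace_ok_def using z F0 initial_less partial_initial
        by (intro exI[of _ "[]"]) (simp add: s2_def s1_def F_def routing_weight_def)
    next
      fix t
      assume fr: "\<And>y. y \<notin> insert ''l'' (mods prog_emit) \<Longrightarrow> t y = s2 y"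
        and inv: "trace_ok (N - N) (F (N * N + initial)) t"
      have "t ''F'' = F" "t ''feasible'' 0 = 1"
        by (simp_all add: fr F_def) (simp_all add: s2_def s1_def)
      with trace_ok_optimal[OF tab[folded F_def], of t] inv show "correct_output I t"
        unfolding correct_output_def optimal_routing_def by auto
    qed (simp_all add: trace_ok_def rep_def output_walks_def)
    then show "runs N (block [Assign ''feasible'' (Const 1), For ''l'' ''N'' prog_emit]) s1
        (correct_output I)"
      unfolding block.simps by (intro runs_Seq runs_Store) (simp add: s2_def)
  next
    assume "val (Cell ''F'' (Plus (Var ''base'') (Var ''i''))) s1 = 0"
    then have "F (N * N + initial) = 0" using z by (simp add: s1_def F_def)
    \<comment> \<open>Any routing would make the entry nonzero, so 0 certifies
      infeasibility.\<close>
    then have "\<not> routing I R A" for R A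
      using table_optimal[OF tab] unfolding F_def by force
    then show "runs N Skip s1 (correct_output I)"
      using z by (intro runs_Skip) (simp add: correct_output_def s1_def)
  qed
  then show ?thesis
    unfolding prog_trace_def block.simps
    by (intro runs_Seq runs_Store) (simp only: init val.simps s1_def)
qed

lemma runs_prog: "runs N prog (input_memory I) (correct_output I)"
proof -
  define s where "s = input_memory I"
  have zero: "s y = (\<lambda>_. 0)" if "y \<notin> {''n'', ''k'', ''adj'', ''w'', ''D'', ''C''}" for y
    using that by (auto simp: s_def input_memory_def Let_def)
  have inp: "input_ok s" unfolding s_def by (rule input_memory_ok)
  show ?thesis
    unfolding prog_def block.simps s_def[symmetric]
  proof (rule runs_SeqI[OF runs_sizes[OF inp]])
    fix s1
    assume fr1: "\<And>y. y \<notin> mods prog_sizes \<Longrightarrow> s1 y = s y" and sz1: "sizes_ok s1"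
    have i1: "input_ok s1" using inp by (simp add: input_ok_def fr1)
    show "runs N (Seq prog_tables (Seq prog_gain (Seq prog_base (Seq prog_layers prog_trace)))) s1
      (correct_output I)"
    proof (rule runs_SeqI[OF runs_tables[OF i1 sz1]])
      fix s2
      assume fr2: "\<And>y. y \<notin> mods prog_tables \<Longrightarrow> s2 y = s1 y" and t2: "tables_upto N s2"
      have i2: "input_ok s2" using i1 by (simp add: input_ok_def fr2)
      have sz2: "sizes_ok s2" using sz1 by (simp add: sizes_ok_def fr2)
      show "runs N (Seq prog_gain (Seq prog_base (Seq prog_layers prog_trace))) s2 (correct_output I)"
      proof (rule runs_SeqI[OF runs_gain[OF i2 sz2 t2]])
        fix s3
        assume fr3: "\<And>y. y \<notin> mods prog_gain \<Longrightarrow> s3 y = s2 y" and g3: "gain_ok s3"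
        have st3: "static s3"
          using i2 sz2 t2 g3
          by (simp add: static_def input_ok_def sizes_ok_def tables_upto_def fr3)
        show "runs N (Seq prog_base (Seq prog_layers prog_trace)) s3 (correct_output I)"
        proof (rule runs_SeqI[OF runs_base[OF st3]])
          fix s4
          assume fr4: "\<And>y. y \<notin> mods prog_base \<Longrightarrow> s4 y = s3 y"
            and F4: "\<forall>i<N. s4 ''F'' i = of_bool (goal i)"
          have st4: "static s4"
            using st3 by (rule static_cong, intro fr4) auto
          show "runs N (Seq prog_layers prog_trace) s4 (correct_output I)"
          proof (rule runs_SeqI[OF runs_layers[OF st4 F4]])
            fix s5
            assume fr5: "\<And>y. y \<notin> mods prog_layers \<Longrightarrow> s5 y = s4 y"
              and t5: "s5 ''base'' 0 = N * N \<and> table (s5 ''F'') (s5 ''ac'') (s5 ''nx'') N"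
            have "static s5"
              using st4 by (rule static_cong, intro fr5) auto
            then show "runs N prog_trace s5 (correct_output I)"
              using t5 by (intro runs_trace) (simp_all add: fr5 fr4 fr3 fr2 fr1 zero)
          qed
        qed (simp add: fr3 fr2 fr1 zero)
      qed (simp add: fr2 fr1 zero)
    qed (simp_all add: fr1 zero)
  qed (simp_all add: zero)
qed

text \<open>The constant is \<open>16 = 2 * 2 ^ 3\<close>: a factor 2 in
  \<open>2 ^ m \<le> 2 * m ^ m\<close> covers \<open>m = 1\<close>, and \<open>2 ^ 3\<close> comes
  from \<open>n + 1 \<le> 2 * n\<close>. For \<open>m = 0\<close> the convention
  \<open>0 ^ 0 = 1\<close> applies.\<close>

lemma N_le: "N \<le> 16 * card (clients I) ^ card (clients I) * n ^ 3"
proof -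
  have "2 ^ m \<le> 2 * m ^ m" for m :: nat
  proof (cases "m \<le> 1")
    case True
    then have "m = 0 \<or> m = 1" by auto
    then show ?thesis by auto
  next
    case False
    then have "2 ^ m \<le> m ^ m" by (intro power_mono) auto
    then show ?thesis by simp
  qed
  then have "M \<le> 2 * card (clients I) ^ card (clients I)"
    unfolding M_def .
  moreover have "(n + 1) ^ 3 \<le> (2 * n) ^ 3"
    using n_pos by (intro power_mono) auto
  ultimately have "M * (n + 1) ^ 3 \<le> 2 * card (clients I) ^ card (clients I) * (2 * n) ^ 3"
    by (rule mult_le_mono)
  then show ?thesis
    by (simp add: N_def power3_eq_cube algebra_simps del: mult_Suc mult_Suc_right)
qed

end

theorem theorem3p2:
  "\<exists>(P :: com) (a :: nat) (b :: nat) (d :: nat).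
     \<forall>I :: nat vrp. vrp_instance I \<and> verts I = {..<card (verts I)} \<longrightarrow>
       (\<exists>t s. exec P (input_memory I) t s \<and>
              correct_output I s \<and>
              t \<le> a * card (clients I) ^ (b * card (clients I)) * card (verts I) ^ d)"
proof -
  \<comment> \<open>Both constants come from the program text, before any instance is fixed, so the
    exponents \<open>r\<close> and \<open>3 * r\<close> below are uniform.\<close>
  obtain a r where cost: "\<And>X. X \<ge> 1 \<Longrightarrow> cost prog X \<le> a * X ^ r"
    using cost_polynomial by blast
  have "\<exists>t s. exec prog (input_memory I) t s \<and> correct_output I s \<and>
      t \<le> (a * 16 ^ r) * card (clients I) ^ (r * card (clients I)) * card (verts I) ^ (3 * r)"
    if I: "vrp_instance I" "verts I = {..<card (verts I)}" for I :: "nat vrp"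
  proof -
    interpret numbered_vrp I "card (verts I)"
      using I by unfold_locales
    obtain t s where t: "exec prog (input_memory I) t s" "t \<le> cost prog N" "correct_output I s"
      using runs_prog unfolding runs_def by blast
    have "N \<ge> 1" using n_le_N by linarith
    then have "t \<le> a * N ^ r" using t(2) cost le_trans by blast
    also have "\<dots> \<le> a * (16 * card (clients I) ^ card (clients I) * card (verts I) ^ 3) ^ r"
      using N_le by (intro mult_le_mono2 power_mono) auto
    also have "\<dots> = (a * 16 ^ r) * card (clients I) ^ (r * card (clients I)) * card (verts I) ^ (3 * r)"
      by (simp add: power_mult_distrib power_mult[symmetric] mult.commute[of r])
    finally show ?thesis using t by blast
  qed
  then show ?thesis by blast
qed

end
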